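(* Let $\Gamma$ be the contact graph of a packing of $N$ disks, $E$ its number of edges, and let $R$, ${\bf a}$, the energy $Q$, the boundary data, and the notion of active edge be as defined in the context. Suppose that the following assumptions hold. (A1) Consider the problem of minimizing the energy $Q$ subject only to the boundary conditions ${\bf u}^i={\bf R}^m({\bf x}^i)$, $i\in I_m$, $m=1,\dots,M$, but not to the linearized impenetrability constraints $({\bf u}^j-{\bf u}^i)\cdot{\bf q}^{ij}\ge 0$ ($j\in\mathcal N_i$, $i=1,\dots,N$). The minimizer of that problem is not feasible, that is, it does not satisfy the linearized impenetrability constraints. Further, the feasible region is not empty: there is at least one ${\bf z}\in\mathbb R^{2(N-N_b)}$ with $R{\bf z}+{\bf a}\ge 0$. (A2) $\Gamma$ is a regular triangulation. (A3) The boundary conditions are prescribed so that $$|({\bf x}^i+{\bf u}^i)-({\bf x}^j+{\bf u}^j)|\le a_i+a_j+\min_{k=1,\dots,N}a_k$$ for each pair ${\bf x}^i,{\bf x}^j$ of boundary vertices in contact. Then there exist $d^\star>0$ and a vector $\boldsymbol\delta=(\delta_1,\dots,\delta_E)\in\mathbb R^E$ with $\delta_l\in(-1,-1/2)$ for $l=1,\dots,E$, such that for each ${\bf d}=d\,\boldsymbol\delta$ with $d>d^\star$, the unique minimizer of the problem $$\text{minimize } F({\bf z})=\tfrac12 d^{-3}(R{\bf z}+{\bf a}+{\bf d})\cdot(R{\bf z}+{\bf a}+{\bf d})\quad\text{subject to } R{\bf z}+{\bf a}\ge 0,\qquad {\bf z}\in\mathbb R^{2(N-N_b)},$$ has the following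 property: each interior vertex ${\bf x}^i$ of $\Gamma$ has at least two active edges $(i,j_1),(i,j_2)$ incident at it, whose corresponding unit vectors ${\bf q}^{ij_1},{\bf q}^{ij_2}$ are linearly independent.
   Context: Packing and contact graph. Consider a packing in $\mathbb R^2$ of disks $D_i$ of radii $a_i>0$ with centers ${\bf x}^i$, $i=1,\dots,N$. The contact graph $\Gamma$ has vertices ${\bf x}^1,\dots,{\bf x}^N$, with ${\bf x}^i,{\bf x}^j$ joined by an edge if and only if $D_i,D_j$ are in contact, i.e. $|{\bf x}^i-{\bf x}^j|=a_i+a_j$. $\mathcal N_i$ is the set of $j$ such that ${\bf x}^j$ is joined to ${\bf x}^i$. Put ${\bf q}^{ij}=({\bf x}^j-{\bf x}^i)/|{\bf x}^j-{\bf x}^i|$. $E$ is the number of edges, indexed $l=1,\dots,E$, the $l$-th edge being $(i_l,j_l)$. The edges of $\Gamma$ form a triangulation of a bounded, connected, convex polygonal domain $\Omega$, i.e. they partition $\Omega$ into a disjoint union of triangles, and $\Gamma$ coincides with the Delaunay graph generated by the set of centers. Boundary conditions. Particles located at the packing boundary (and the corresponding vertices of $\Gamma$) are called boundary particles (vertices); all others are interior. The boundary particles are divided into groups $1,\dots,M$ with index sets $I_1,\dots,I_M$; each disk in a group is in contact with at least one other disk of the same group. $N_b=\sum_m\mathrm{card}(I_m)$. Displacements ${\bf u}^i\in\mathbb R^2$ of boundary vertices are prescribed: ${\bf u}^i={\bf R}^m({\bf x}^i)={\bf c}^m+\alpha^mK({\bf x}^i-{\bf x}^{\star,m})$ for $i\in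 I_m$, with given vectors ${\bf c}^m,{\bf x}^{\star,m}\in\mathbb R^2$, given scalars $\alpha^m$, and $K=\begin{pmatrix}0&1\\-1&0\end{pmatrix}$. Vertices are numbered so that the boundary vertices are the last $N_b$. Energy. With parameters $d>0$ and $d_{ij}=d\,\delta_{ij}$, $\delta_{ij}\in[1/2,1]$, for the edges, $$Q({\bf u}^1,\dots,{\bf u}^N)=\tfrac12d^{-3}\sum_{i=1}^N\sum_{j\in\mathcal N_i}\big(({\bf u}^j-{\bf u}^i)\cdot{\bf q}^{ij}-d_{ij}\big)^2 .$$ In vector form ${\bf d}=-(d_{i_1j_1},\dots,d_{i_Ej_E})\in\mathbb R^E$. Matrices. $R^r$ is the $E\times2N$ rigidity matrix: for ${\bf U}=({\bf u}^1,\dots,{\bf u}^N)$, $(R^r{\bf U})_l=({\bf u}^{j_l}-{\bf u}^{i_l})\cdot{\bf q}^{i_lj_l}$. Write $R^r=[R\,|\,R^b]$ with $R$ of size $E\times2(N-N_b)$ (columns of interior vertices) and $R^b$ of size $E\times2N_b$. Let ${\bf g}\in\mathbb R^{2N_b}$ be the vector of prescribed boundary displacements and ${\bf a}=R^b{\bf g}$. For ${\bf z}=({\bf u}^1,\dots,{\bf u}^{N-N_b})$, $(R{\bf z}+{\bf a})_l=({\bf u}^{j_l}-{\bf u}^{i_l})\cdot{\bf q}^{i_lj_l}$ with boundary displacements equal to the prescribed ones. Vector inequalities are componentwise. For a feasible ${\bf z}$ (i.e. $R{\bf z}+{\bf a}\ge0$), the edge $l$ is active if $(R{\bf z}+{\bf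 a})_l=0$, and inactive otherwise. Standing assumption (no new contacts). Contacts existing in the reference configuration may be broken, but no new contacts are created after applying the boundary conditions; consequently, if the displacements satisfy $|({\bf x}^i+{\bf u}^i)-({\bf x}^j+{\bf u}^j)|\ge a_i+a_j$ for each pair of particles in contact, then this inequality holds for every pair of particles. Cell-connected. For a set $X$ of interior vertices containing at least two elements, $G_X$ is the subgraph of $\Gamma$ with vertex set $X$ whose edges are all edges of $\Gamma$ joining two vertices of $X$. $\Gamma$ is cell-connected if for each such $X$ with $G_X$ connected there exist two vertices ${\bf x}^1,{\bf x}^2$ in $G_X$ and two interior vertices $\hat{\bf x}^1,\hat{\bf x}^2$ in $\Gamma\setminus G_X$ such that the quadrilateral with vertices ${\bf x}^1,{\bf x}^2,\hat{\bf x}^1,\hat{\bf x}^2$ is a union of two adjacent triangles of $\Gamma$. Regular triangulation. $\Gamma$ is a regular triangulation if: (i) $\Gamma$ can be obtained by sequential addition of triangles: starting from a single triangle, each graph $G_{k+1}$ is obtained by combining the triangulation $G_k$ with a triangle that either shares two vertices and the edge between them with $G_k$ (so $G_{k+1}$ has one more vertex and two more edges) or shares all three vertices with $G_k$ (so $G_{k+1}$ has the same vertices and one more edge); (ii) every interior vertex connected by an edge to a boundary vertex is also connected to at least one other boundary vertex, and the corresponding edges are non-collinear; (iii) $\Gamma$ is cell-connected. *)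

theory Defs
  imports "HOL-Analysis.Analysis"
begin

(* The vertices are the elements of the finite type 'i + 'b: the vertices Inl i are the N - N_b
   interior ones, the vertices Inr b the N_b boundary ones (see located_wrt), so N = CARD('i + 'b).
   The edges are enumerated by the finite type 'e, so E = CARD('e). Vectors in R^(2N), R^(2(N-N_b)),
   R^(2N_b) and R^E are elements of real^2^('i + 'b), real^2^'i, real^2^'b and real^'e. *)

section \<open>Packing and contact graph\<close>

definition disk_packing :: "('v \<Rightarrow> real^2) \<Rightarrow> ('v \<Rightarrow> real) \<Rightarrow> bool" where
  "disk_packing x rad \<longleftrightarrow>
     (\<forall>i. rad i > 0) \<and>
     (\<forall>i j. i \<noteq> j \<longrightarrow> ball (x i) (rad i) \<inter> ball (x j) (rad j) = {})"

definition contact :: "('v \<Rightarrow> real^2) \<Rightarrow> ('v \<Rightarrow> real) \<Rightarrow> 'v \<Rightarrow> 'v \<Rightarrow> bool" where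
  "contact x rad i j \<longleftrightarrow> i \<noteq> j \<and> norm (x i - x j) = rad i + rad j"

definition contact_edges :: "('v \<Rightarrow> real^2) \<Rightarrow> ('v \<Rightarrow> real) \<Rightarrow> 'v set set" where
  "contact_edges x rad = {{i, j} | i j. contact x rad i j}"

definition nbrs :: "('v \<Rightarrow> real^2) \<Rightarrow> ('v \<Rightarrow> real) \<Rightarrow> 'v \<Rightarrow> 'v set" where
  "nbrs x rad i = {j. contact x rad i j}"

definition qvec :: "('v \<Rightarrow> real^2) \<Rightarrow> 'v \<Rightarrow> 'v \<Rightarrow> real^2" where
  "qvec x i j = (x j - x i) /\<^sub>R norm (x j - x i)"

(* src l and tgt l are i_l and j_l; each edge is listed exactly once, with an arbitrary
   orientation. *)
definition edge_enum ::
  "('v \<Rightarrow> real^2) \<Rightarrow> ('v \<Rightarrow> real) \<Rightarrow> ('e \<Rightarrow> 'v) \<Rightarrow> ('e \<Rightarrow> 'v) \<Rightarrow> bool" where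
  "edge_enum x rad src tgt \<longleftrightarrow> bij_betw (\<lambda>l. {src l, tgt l}) UNIV (contact_edges x rad)"


section \<open>Triangulations\<close>

definition polygonal_domain :: "(real^2) set \<Rightarrow> bool" where
  "polygonal_domain \<Omega> \<longleftrightarrow>
     open \<Omega> \<and> \<Omega> \<noteq> {} \<and> bounded \<Omega> \<and> connected \<Omega> \<and> convex \<Omega> \<and> polytope (closure \<Omega>)"

(* A triangle is represented by the set of its three vertices. *)
definition tri_edges :: "'v set \<Rightarrow> 'v set set" where
  "tri_edges T = {e. e \<subseteq> T \<and> card e = 2}"

definition triangulates ::
  "('v \<Rightarrow> real^2) \<Rightarrow> ('v \<Rightarrow> real) \<Rightarrow> (real^2) set \<Rightarrow> 'v set set \<Rightarrow> bool" where
  "triangulates x rad \<Omega> \<tau> \<longleftrightarrow>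
     (\<forall>T\<in>\<tau>. card T = 3 \<and> \<not> collinear (x ` T)) \<and>
     triangulation ((\<lambda>T. convex hull (x ` T)) ` \<tau>) \<and>
     (\<Union>T\<in>\<tau>. convex hull (x ` T)) = closure \<Omega> \<and>
     (\<Union>T\<in>\<tau>. tri_edges T) = contact_edges x rad \<and>
     \<Union>\<tau> = UNIV"

(* The Delaunay graph is the dual of the Voronoi diagram: two sites are joined iff their
   Voronoi cells share an edge (not merely a point). *)
definition voronoi_cell :: "('v \<Rightarrow> real^2) \<Rightarrow> 'v \<Rightarrow> (real^2) set" where
  "voronoi_cell x i = {p. \<forall>k. dist p (x i) \<le> dist p (x k)}"

definition delaunay_adj :: "('v \<Rightarrow> real^2) \<Rightarrow> 'v \<Rightarrow> 'v \<Rightarrow> bool" where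
  "delaunay_adj x i j \<longleftrightarrow> i \<noteq> j \<and> aff_dim (voronoi_cell x i \<inter> voronoi_cell x j) = 1"

definition delaunay_contact_graph :: "('v \<Rightarrow> real^2) \<Rightarrow> ('v \<Rightarrow> real) \<Rightarrow> bool" where
  "delaunay_contact_graph x rad \<longleftrightarrow> (\<forall>i j. contact x rad i j \<longleftrightarrow> delaunay_adj x i j)"

definition located_wrt :: "('i + 'b \<Rightarrow> real^2) \<Rightarrow> (real^2) set \<Rightarrow> bool" where
  "located_wrt x \<Omega> \<longleftrightarrow> (\<forall>i. x (Inl i) \<in> \<Omega>) \<and> (\<forall>b. x (Inr b) \<in> frontier \<Omega>)"

(* The graphs G_k, as pairs of a vertex set and an edge set, obtained by sequential addition of
   triangles from \<tau>. *)
inductive triangle_built :: "'v set set \<Rightarrow> 'v set \<Rightarrow> 'v set set \<Rightarrow> bool" for \<tau> where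
  start: "T \<in> \<tau> \<Longrightarrow> triangle_built \<tau> T (tri_edges T)"
| add_vertex: "triangle_built \<tau> V Es \<Longrightarrow> T \<in> \<tau> \<Longrightarrow> T \<inter> V = {i, j} \<Longrightarrow> i \<noteq> j \<Longrightarrow> {i, j} \<in> Es
     \<Longrightarrow> triangle_built \<tau> (V \<union> T) (Es \<union> tri_edges T)"
| add_edge: "triangle_built \<tau> V Es \<Longrightarrow> T \<in> \<tau> \<Longrightarrow> T \<subseteq> V \<Longrightarrow> card (tri_edges T - Es) = 1
     \<Longrightarrow> triangle_built \<tau> V (Es \<union> tri_edges T)"

definition induced_connected ::
  "('v \<Rightarrow> real^2) \<Rightarrow> ('v \<Rightarrow> real) \<Rightarrow> 'v set \<Rightarrow> bool" where
  "induced_connected x rad X \<longleftrightarrow>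
     (\<forall>i\<in>X. \<forall>j\<in>X. (i, j) \<in> {(k, l). k \<in> X \<and> l \<in> X \<and> contact x rad k l}\<^sup>*)"

(* The four vertices below are automatically distinct, as a union of two adjacent triangles has
   four vertices. *)
definition cell_connected ::
  "('i + 'b \<Rightarrow> real^2) \<Rightarrow> ('i + 'b \<Rightarrow> real) \<Rightarrow> ('i + 'b) set set \<Rightarrow> bool" where
  "cell_connected x rad \<tau> \<longleftrightarrow>
     (\<forall>X. X \<subseteq> range Inl \<and> card X \<ge> 2 \<and> induced_connected x rad X \<longrightarrow>
       (\<exists>v1\<in>X. \<exists>v2\<in>X. \<exists>w1\<in>range Inl - X. \<exists>w2\<in>range Inl - X. \<exists>T1\<in>\<tau>. \<exists>T2\<in>\<tau>.
          T1 \<noteq> T2 \<and> card (T1 \<inter> T2) = 2 \<and> T1 \<union> T2 = {v1, v2, w1, w2}))"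

definition boundary_connected ::
  "('i + 'b \<Rightarrow> real^2) \<Rightarrow> ('i + 'b \<Rightarrow> real) \<Rightarrow> bool" where
  "boundary_connected x rad \<longleftrightarrow>
     (\<forall>i b. contact x rad (Inl i) (Inr b) \<longrightarrow>
       (\<exists>b'. b' \<noteq> b \<and> contact x rad (Inl i) (Inr b') \<and>
             \<not> collinear {x (Inl i), x (Inr b), x (Inr b')}))"

definition regular_triangulation ::
  "('i + 'b \<Rightarrow> real^2) \<Rightarrow> ('i + 'b \<Rightarrow> real) \<Rightarrow> ('i + 'b) set set \<Rightarrow> bool" where
  "regular_triangulation x rad \<tau> \<longleftrightarrow>
     triangle_built \<tau> UNIV (contact_edges x rad) \<and>
     boundary_connected x rad \<and>
     cell_connected x rad \<tau>"


section \<open>Boundary conditions\<close>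

definition Kmat :: "real^2^2" where
  "Kmat = vector [vector [0, 1], vector [-1, 0]]"

definition boundary_groups ::
  "('i + 'b \<Rightarrow> real^2) \<Rightarrow> ('i + 'b \<Rightarrow> real) \<Rightarrow> nat \<Rightarrow> (nat \<Rightarrow> 'b set) \<Rightarrow> bool" where
  "boundary_groups x rad M I \<longleftrightarrow>
     (\<Union>m\<in>{1..M}. I m) = UNIV \<and> disjoint_family_on I {1..M} \<and>
     (\<forall>m\<in>{1..M}. \<forall>b\<in>I m. \<exists>b'\<in>I m. contact x rad (Inr b) (Inr b'))"

definition boundary_data ::
  "('i::finite + 'b::finite \<Rightarrow> real^2) \<Rightarrow> nat \<Rightarrow> (nat \<Rightarrow> 'b set) \<Rightarrow> (nat \<Rightarrow> real^2) \<Rightarrow> (nat \<Rightarrow> real) \<Rightarrow>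
   (nat \<Rightarrow> real^2) \<Rightarrow> real^2^'b \<Rightarrow> bool" where
  "boundary_data x M I c \<alpha> xstar g \<longleftrightarrow>
     (\<forall>m\<in>{1..M}. \<forall>b\<in>I m. g $ b = c m + \<alpha> m *\<^sub>R (Kmat *v (x (Inr b) - xstar m)))"

definition satisfies_bc :: "real^2^('b::finite) \<Rightarrow> real^2^('i::finite + 'b) \<Rightarrow> bool" where
  "satisfies_bc g u \<longleftrightarrow> (\<forall>b. u $ Inr b = g $ b)"


section \<open>Energy and rigidity matrix\<close>

definition lin_impenetrable ::
  "('v::finite \<Rightarrow> real^2) \<Rightarrow> ('v \<Rightarrow> real) \<Rightarrow> real^2^'v \<Rightarrow> bool" where
  "lin_impenetrable x rad u \<longleftrightarrow> (\<forall>i. \<forall>j\<in>nbrs x rad i. (u $ j - u $ i) \<bullet> qvec x i j \<ge> 0)"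

definition energyQ ::
  "('v::finite \<Rightarrow> real^2) \<Rightarrow> ('v \<Rightarrow> real) \<Rightarrow> real \<Rightarrow> ('v \<Rightarrow> 'v \<Rightarrow> real) \<Rightarrow> real^2^'v \<Rightarrow> real" where
  "energyQ x rad d \<delta> u =
     1/2 * (1 / d^3) * (\<Sum>i\<in>UNIV. \<Sum>j\<in>nbrs x rad i. ((u $ j - u $ i) \<bullet> qvec x i j - d * \<delta> i j)\<^sup>2)"

(* Matrices are represented by the linear maps they induce; Rint and Rbdry below are the column
   blocks R and R^b of R^r. *)
definition Rr ::
  "('v::finite \<Rightarrow> real^2) \<Rightarrow> ('e::finite \<Rightarrow> 'v) \<Rightarrow> ('e \<Rightarrow> 'v) \<Rightarrow> real^2^'v \<Rightarrow> real^'e" where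
  "Rr x src tgt U = (\<chi> l. (U $ tgt l - U $ src l) \<bullet> qvec x (src l) (tgt l))"

definition stack :: "real^2^('i::finite) \<Rightarrow> real^2^('b::finite) \<Rightarrow> real^2^('i + 'b)" where
  "stack z g = (\<chi> v. case v of Inl i \<Rightarrow> z $ i | Inr b \<Rightarrow> g $ b)"

definition Rint ::
  "('i::finite + 'b::finite \<Rightarrow> real^2) \<Rightarrow> ('e::finite \<Rightarrow> 'i + 'b) \<Rightarrow> ('e \<Rightarrow> 'i + 'b) \<Rightarrow> real^2^'i \<Rightarrow> real^'e" where
  "Rint x src tgt z = Rr x src tgt (stack z 0)"

definition Rbdry ::
  "('i::finite + 'b::finite \<Rightarrow> real^2) \<Rightarrow> ('e::finite \<Rightarrow> 'i + 'b) \<Rightarrow> ('e \<Rightarrow> 'i + 'b) \<Rightarrow> real^2^'b \<Rightarrow> real^'e" where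
  "Rbdry x src tgt g = Rr x src tgt (stack 0 g)"

(* The order on real^'e is componentwise. *)
definition feasible ::
  "('i::finite + 'b::finite \<Rightarrow> real^2) \<Rightarrow> ('e::finite \<Rightarrow> 'i + 'b) \<Rightarrow> ('e \<Rightarrow> 'i + 'b) \<Rightarrow> real^'e \<Rightarrow> real^2^'i \<Rightarrow> bool" where
  "feasible x src tgt a z \<longleftrightarrow> Rint x src tgt z + a \<ge> 0"

definition active ::
  "('i::finite + 'b::finite \<Rightarrow> real^2) \<Rightarrow> ('e::finite \<Rightarrow> 'i + 'b) \<Rightarrow> ('e \<Rightarrow> 'i + 'b) \<Rightarrow> real^'e \<Rightarrow> real^2^'i \<Rightarrow> 'e \<Rightarrow> bool"
  where "active x src tgt a z l \<longleftrightarrow> (Rint x src tgt z + a) $ l = 0"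

definition objF ::
  "('i::finite + 'b::finite \<Rightarrow> real^2) \<Rightarrow> ('e::finite \<Rightarrow> 'i + 'b) \<Rightarrow> ('e \<Rightarrow> 'i + 'b) \<Rightarrow> real^'e \<Rightarrow>
   real \<Rightarrow> real^'e \<Rightarrow> real^2^'i \<Rightarrow> real" where
  "objF x src tgt a d dvec z =
     1/2 * (1 / d^3) * ((Rint x src tgt z + a + dvec) \<bullet> (Rint x src tgt z + a + dvec))"

(* The displacements ranged over are those admissible in the model: they satisfy the boundary
   conditions and the linearized impenetrability constraints. Ranging over all displacements
   would be too strong, as two interior disks not in contact could then be
   carried far away onto each other. *)
definition no_new_contacts ::
  "('i::finite + 'b::finite \<Rightarrow> real^2) \<Rightarrow> ('i + 'b \<Rightarrow> real) \<Rightarrow> real^2^'b \<Rightarrow> bool" where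
  "no_new_contacts x rad g \<longleftrightarrow>
     (\<forall>u. satisfies_bc g u \<and> lin_impenetrable x rad u \<longrightarrow>
        (\<forall>i j. contact x rad i j \<longrightarrow>
           norm ((x i + u $ i) - (x j + u $ j)) \<ge> rad i + rad j) \<longrightarrow>
        (\<forall>i j. i \<noteq> j \<longrightarrow> norm ((x i + u $ i) - (x j + u $ j)) \<ge> rad i + rad j))"

end

theory Submission
  imports Defs
begin

text \<open>The edge elongations \<open>y = R z + a\<close> of feasible displacements form a polyhedron \<open>Y\<close>, and \<open>F\<close>
  selects the point of \<open>Y\<close> closest to \<open>- d \<delta>\<close>.

  \<open>Y\<close> is bounded: three mutually tangent disks have their contact points on the incircle of the triangle
  of their centres, so giving each edge the sum of the inradii of its adjacent triangles defines a
  strictly positive stress \<open>\<omega>\<close> that is in equilibrium at the interior vertices. Hence \<open>\<omega>\<close> is orthogonal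
  to the range of \<open>R\<close>, and \<open>\<omega> \<bullet> y\<close> is constant on \<open>Y\<close>.

  \<open>R\<close> is injective: a graph built up from triangles is infinitesimally rigid, and two touching boundary
  disks are fixed.

  For a suitable \<open>\<delta>\<close> near \<open>-3/4\<close> the functional \<open>\<delta> \<bullet> y\<close> has a sharp minimum on the polytope \<open>Y\<close>, at a
  point that does not depend on \<open>d\<close> and is the closest point to \<open>- d \<delta>\<close> for all large \<open>d\<close>. A sharp
  minimum admits no segment of \<open>Y\<close> through it. If the active edges at an interior vertex did not span the
  plane, moving this vertex alone would give such a segment.\<close>

section \<open>Sharp minima on polytopes\<close>

text \<open>Linear growth away from \<open>v\<close>, the quantitative form of unique minimality. It
  is stable: adding to \<open>d *\<^sub>R p\<close> a vector of norm at most
  \<open>d * \<kappa>\<close> cannot move the minimum.\<close>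

definition sharp_min :: "'a::real_inner set \<Rightarrow> 'a \<Rightarrow> 'a \<Rightarrow> bool" where
  "sharp_min Y p v \<longleftrightarrow> v \<in> Y \<and> (\<exists>\<kappa>>0. \<forall>y\<in>Y. p \<bullet> (y - v) \<ge> \<kappa> * norm (y - v))"

text \<open>There are only finitely many extreme points to compare with \<open>v\<close>, so the
  slopes towards them have a positive minimum, and convex combinations inherit it.\<close>

lemma sharp_minI_polytope:
  fixes Y :: "'a::euclidean_space set"
  assumes "polytope Y" "v \<in> Y" and strict: "\<And>y. y \<in> Y \<Longrightarrow> y \<noteq> v \<Longrightarrow> p \<bullet> (y - v) > 0"
  shows "sharp_min Y p v"
proof -
  obtain S where S: "finite S" "Y = convex hull S"
    using assms(1) by (auto simp: polytope_def)
  \<comment> \<open>The entry 1 keeps the set nonempty when \<open>S\<close> has no point other than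
    \<open>v\<close>.\<close>
  define \<kappa> where "\<kappa> = Min (insert 1 ((\<lambda>s. p \<bullet> (s - v) / norm (s - v)) ` (S - {v})))"
  have SY: "S \<subseteq> Y" by (simp add: S(2) hull_subset)
  have "\<kappa> > 0"
    unfolding \<kappa>_def using S(1) SY strict by (subst Min_gr_iff) (auto intro!: divide_pos_pos)
  have vertex: "p \<bullet> (s - v) \<ge> \<kappa> * norm (s - v)" if "s \<in> S" for s
  proof (cases "s = v")
    case False
    then have "\<kappa> \<le> p \<bullet> (s - v) / norm (s - v)"
      unfolding \<kappa>_def using S(1) that by (intro Min_le) auto
    with False show ?thesis by (simp add: field_simps)
  qed simp
  have "p \<bullet> (y - v) \<ge> \<kappa> * norm (y - v)" if "y \<in> Y" for y
  proof -
    obtain u where u: "\<And>s. s \<in> S \<Longrightarrow> 0 \<le> u s" "sum u S = 1" "(\<Sum>s\<in>S. u s *\<^sub>R s) = y"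
      using \<open>y \<in> Y\<close> unfolding S(2) convex_hull_finite[OF S(1)] by blast
    have yv: "y - v = (\<Sum>s\<in>S. u s *\<^sub>R (s - v))"
      by (simp add: scaleR_diff_right sum_subtractf u flip: scaleR_left.sum)
    have "\<kappa> * norm (y - v) \<le> \<kappa> * (\<Sum>s\<in>S. u s * norm (s - v))"
      using \<open>\<kappa> > 0\<close> u(1) unfolding yv
      by (intro mult_left_mono order.trans[OF norm_sum] sum_mono) auto
    also have "\<dots> = (\<Sum>s\<in>S. u s * (\<kappa> * norm (s - v)))"
      by (simp add: sum_distrib_left mult_ac)
    also have "\<dots> \<le> (\<Sum>s\<in>S. u s * (p \<bullet> (s - v)))"
      by (intro sum_mono mult_left_mono vertex u)
    also have "\<dots> = p \<bullet> (y - v)"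
      by (simp add: yv inner_sum_right)
    finally show ?thesis .
  qed
  with \<open>\<kappa> > 0\<close> assms(2) show ?thesis by (auto simp: sharp_min_def)
qed

text \<open>A minimiser \<open>v\<close> of the concave function \<open>y \<mapsto> p \<bullet> y - \<epsilon> \<bar>y\<bar>\<^sup>2\<close> is the only minimiser
  of the linear functional with gradient \<open>p - 2 \<epsilon> v\<close>.\<close>

lemma exists_sharp_min_near:
  fixes Y :: "'a::euclidean_space set"
  assumes "polytope Y" "Y \<noteq> {}" "\<eta> > 0"
  obtains q v where "norm (q - p) < \<eta>" "sharp_min Y q v"
proof -
  obtain B where B: "B > 0" "\<And>y. y \<in> Y \<Longrightarrow> norm y \<le> B"
    using polytope_imp_bounded[OF assms(1)] by (auto simp: bounded_pos)
  \<comment> \<open>Chosen so that \<open>2 * \<epsilon> * B\<close> is half of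
    \<open>\<eta>\<close>.\<close>
  define \<epsilon> where "\<epsilon> = \<eta> / (4 * B)"
  have \<epsilon>: "\<epsilon> > 0" using B(1) assms(3) by (simp add: \<epsilon>_def)
  have "continuous_on Y (\<lambda>y. p \<bullet> y - \<epsilon> * (y \<bullet> y))"
    by (intro continuous_intros)
  then obtain v where v: "v \<in> Y" "\<And>y. y \<in> Y \<Longrightarrow> p \<bullet> v - \<epsilon> * (v \<bullet> v) \<le> p \<bullet> y - \<epsilon> * (y \<bullet> y)"
    using continuous_attains_inf[OF polytope_imp_compact[OF assms(1)] assms(2)] by blast
  define q where "q = p - (2 * \<epsilon>) *\<^sub>R v"
  have "norm (q - p) = 2 * \<epsilon> * norm v" using \<epsilon> by (simp add: q_def)
  also have "\<dots> \<le> 2 * \<epsilon> * B" using B(2) v(1) \<epsilon> by (intro mult_left_mono) auto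
  also have "\<dots> < \<eta>" using B(1) assms(3) by (simp add: \<epsilon>_def)
  finally have "norm (q - p) < \<eta>" .
  moreover have "sharp_min Y q v"
  proof (rule sharp_minI_polytope[OF assms(1) v(1)])
    fix y assume y: "y \<in> Y" "y \<noteq> v"
    \<comment> \<open>The quadratic term expands as |y|^2 - |v|^2 = 2 v \<bullet> (y - v) + |y -
      v|^2. The linear part goes into \<open>q\<close>, the square remains as a gain.\<close>
    have "0 < \<epsilon> * ((y - v) \<bullet> (y - v))" using \<epsilon> y by simp
    also have "\<dots> \<le> q \<bullet> (y - v)"
      using v(2)[OF y(1)] by (simp add: q_def inner_simps inner_commute algebra_simps)
    finally show "q \<bullet> (y - v) > 0" .
  qed
  ultimately show ?thesis using that by blast
qed

text \<open>Adding the growth bounds at \<open>v + h\<close> and \<open>v - h\<close> cancels the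
  linear terms.\<close>

lemma sharp_min_translate_eq:
  assumes "sharp_min Y p v" "v + h \<in> Y" "v - h \<in> Y"
  shows "h = 0"
proof -
  obtain \<kappa> where "\<kappa> > 0" "\<And>y. y \<in> Y \<Longrightarrow> p \<bullet> (y - v) \<ge> \<kappa> * norm (y - v)"
    using assms(1) by (auto simp: sharp_min_def)
  from this(2)[OF assms(2)] this(2)[OF assms(3)] have "\<kappa> * norm h \<le> 0" by simp
  with \<open>\<kappa> > 0\<close> show ?thesis by (simp add: mult_le_0_iff)
qed

text \<open>The first-order condition for \<open>v\<close> to be closest to
  \<open>- d *\<^sub>R p\<close> is (v + d p) \<bullet> (y - v) \<ge> 0. By Cauchy-Schwarz the sharp
  growth outweighs the term v \<bullet> (y - v) for large \<open>d\<close>. The surplus square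
  yields uniqueness.\<close>

lemma sharp_min_projection:
  fixes Y :: "'a::real_inner set"
  assumes "sharp_min Y p v"
  obtains D where "D > 0"
    "\<And>d y. d > D \<Longrightarrow> y \<in> Y \<Longrightarrow>
       (y + d *\<^sub>R p) \<bullet> (y + d *\<^sub>R p) \<ge> (v + d *\<^sub>R p) \<bullet> (v + d *\<^sub>R p) + (y - v) \<bullet> (y - v)"
proof -
  obtain \<kappa> where \<kappa>: "\<kappa> > 0" "\<And>y. y \<in> Y \<Longrightarrow> p \<bullet> (y - v) \<ge> \<kappa> * norm (y - v)"
    using assms by (auto simp: sharp_min_def)
  show ?thesis
  \<comment> \<open>From \<open>norm v / \<kappa>\<close> on, \<open>d * \<kappa>\<close> dominates
    \<open>norm v\<close>; the summand 1 makes the threshold positive even for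
    \<open>v = 0\<close>.\<close>
  proof (rule that[of "norm v / \<kappa> + 1"])
    show "norm v / \<kappa> + 1 > 0" using \<kappa>(1) by (simp add: add_nonneg_pos)
    fix d y assume d: "d > norm v / \<kappa> + 1" and y: "y \<in> Y"
    have "norm v \<le> d * \<kappa>" using d \<kappa>(1) by (simp add: field_simps)
    have "d > 0" using d \<kappa>(1) by (smt (verit) divide_nonneg_pos norm_ge_zero)
    have "- (v \<bullet> (y - v)) \<le> norm v * norm (y - v)"
      using Cauchy_Schwarz_ineq2[of v "y - v"] by linarith
    also have "\<dots> \<le> d * (\<kappa> * norm (y - v))"
      using mult_right_mono[OF \<open>norm v \<le> d * \<kappa>\<close>, of "norm (y - v)"] by (simp add: mult_ac)
    also have "\<dots> \<le> d * (p \<bullet> (y - v))"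
      using \<kappa>(2)[OF y] \<open>d > 0\<close> by (intro mult_left_mono) auto
    finally have "0 \<le> 2 * ((v + d *\<^sub>R p) \<bullet> (y - v))" by (simp add: inner_simps algebra_simps)
    then show "(y + d *\<^sub>R p) \<bullet> (y + d *\<^sub>R p) \<ge> (v + d *\<^sub>R p) \<bullet> (v + d *\<^sub>R p) + (y - v) \<bullet> (y - v)"
      by (simp add: inner_simps inner_commute algebra_simps)
  qed
qed

text \<open>Pulls the sharp minimum back along the injective map \<open>L\<close>. The same
  \<open>z\<close> serves for every \<open>d > D\<close>, and the last conclusion says that
  \<open>z\<close> is a vertex of the feasible polyhedron.\<close>

lemma least_squares_at_vertex:
  fixes L :: "'a::real_vector \<Rightarrow> real^'e::finite" and a p :: "real^'e"
  assumes L: "linear L" "inj L"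
    and poly: "polytope {y \<in> range (\<lambda>z. L z + a). 0 \<le> y}"
    and feas: "0 \<le> L z0 + a" and "\<eta> > 0"
  obtains \<delta> z D where "norm (\<delta> - p) < \<eta>" "D > 0"
    "\<And>d z'. d > D \<Longrightarrow> is_arg_min (\<lambda>z. (L z + a + d *\<^sub>R \<delta>) \<bullet> (L z + a + d *\<^sub>R \<delta>)) (\<lambda>z. 0 \<le> L z + a) z'
        \<longleftrightarrow> z' = z"
    "\<forall>h. (\<forall>l. (L z + a) $ l = 0 \<longrightarrow> L h $ l = 0) \<longrightarrow> h = 0"
proof -
  define Y where "Y = {y \<in> range (\<lambda>z. L z + a). 0 \<le> y}"
  have mem_Y: "L z + a \<in> Y \<longleftrightarrow> 0 \<le> L z + a" for z by (auto simp: Y_def)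
  have "Y \<noteq> {}" using feas mem_Y by blast
  then obtain \<delta> v where \<delta>: "norm (\<delta> - p) < \<eta>" "sharp_min Y \<delta> v"
    using exists_sharp_min_near[of Y \<eta> p] poly \<open>\<eta> > 0\<close> unfolding Y_def by blast
  then obtain z where z: "v = L z + a" "0 \<le> L z + a"
    by (auto simp: sharp_min_def Y_def)
  obtain D where D: "D > 0" "\<And>d y. d > D \<Longrightarrow> y \<in> Y \<Longrightarrow>
      (y + d *\<^sub>R \<delta>) \<bullet> (y + d *\<^sub>R \<delta>) \<ge> (v + d *\<^sub>R \<delta>) \<bullet> (v + d *\<^sub>R \<delta>) + (y - v) \<bullet> (y - v)"
    using sharp_min_projection[OF \<delta>(2)] by blast
  show ?thesis
  proof (rule that[OF \<delta>(1) D(1)])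
    fix d z' assume d: "d > D"
    let ?f = "\<lambda>z. (L z + a + d *\<^sub>R \<delta>) \<bullet> (L z + a + d *\<^sub>R \<delta>)"
    have ge: "?f z'' \<ge> ?f z + (L z'' - L z) \<bullet> (L z'' - L z)" if "0 \<le> L z'' + a" for z''
      using D(2)[OF d, of "L z'' + a"] that by (simp add: mem_Y z(1))
    have "is_arg_min ?f (\<lambda>z. 0 \<le> L z + a) z"
      unfolding is_arg_min_def using z(2) ge by (smt (verit) inner_ge_zero)
    moreover have "z' = z" if z': "is_arg_min ?f (\<lambda>z. 0 \<le> L z + a) z'"
    proof -
      have "0 \<le> L z' + a" "?f z' \<le> ?f z"
        using z' z(2) unfolding is_arg_min_def by (auto simp: not_less)
      with ge[of z'] have "(L z' - L z) \<bullet> (L z' - L z) \<le> 0" by linarith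
      then have "L z' = L z" by (metis inner_gt_zero_iff not_le right_minus_eq)
      with L(2) show ?thesis by (auto dest: injD)
    qed
    ultimately show "is_arg_min ?f (\<lambda>z. 0 \<le> L z + a) z' \<longleftrightarrow> z' = z" by blast
  next
    show "\<forall>h. (\<forall>l. (L z + a) $ l = 0 \<longrightarrow> L h $ l = 0) \<longrightarrow> h = 0"
    proof (intro allI impI)
      fix h assume h: "\<forall>l. (L z + a) $ l = 0 \<longrightarrow> L h $ l = 0"
      \<comment> \<open>A step short enough to preserve every strict inequality in both directions.
        Coordinates with \<open>v $ l = 0\<close> impose no bound, as \<open>L h\<close> vanishes
        there; adding 1 in the denominators avoids division by zero.\<close>
      define \<epsilon> where "\<epsilon> = Min (insert 1 ((\<lambda>l. v $ l / (1 + \<bar>L h $ l\<bar>)) ` {l. v $ l > 0}))"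
      have "\<epsilon> > 0" unfolding \<epsilon>_def by (subst Min_gr_iff) (auto intro!: divide_pos_pos)
      have small: "\<bar>\<epsilon> * L h $ l\<bar> \<le> v $ l" for l
      proof (cases "v $ l = 0")
        case True
        then show ?thesis using h by (simp add: z(1))
      next
        case False
        then have "v $ l > 0" using z by (simp add: less_eq_vec_def order_less_le)
        then have "\<epsilon> \<le> v $ l / (1 + \<bar>L h $ l\<bar>)" unfolding \<epsilon>_def by (intro Min_le) auto
        then have "\<epsilon> * (1 + \<bar>L h $ l\<bar>) \<le> v $ l" by (simp add: pos_le_divide_eq add_pos_nonneg)
        then have "\<epsilon> * \<bar>L h $ l\<bar> \<le> v $ l" using \<open>\<epsilon> > 0\<close> by (simp add: distrib_left)
        then show ?thesis using \<open>\<epsilon> > 0\<close> by (simp add: abs_mult)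
      qed
      have "0 \<le> v + \<epsilon> *\<^sub>R L h" "0 \<le> v - \<epsilon> *\<^sub>R L h"
        using small by (simp_all add: less_eq_vec_def abs_le_iff) (smt (verit) small)+
      moreover have "v + \<epsilon> *\<^sub>R L h = L (z + \<epsilon> *\<^sub>R h) + a" "v - \<epsilon> *\<^sub>R L h = L (z - \<epsilon> *\<^sub>R h) + a"
        by (simp_all add: z(1) linear_add[OF L(1)] linear_diff[OF L(1)] linear_cmul[OF L(1)])
      ultimately have "v + \<epsilon> *\<^sub>R L h \<in> Y" "v - \<epsilon> *\<^sub>R L h \<in> Y" by (auto simp: Y_def)
      then have "\<epsilon> *\<^sub>R L h = 0" by (rule sharp_min_translate_eq[OF \<delta>(2)])
      then have "L h = L 0" using \<open>\<epsilon> > 0\<close> by (simp add: linear_0[OF L(1)])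
      with L(2) show "h = 0" by (auto dest: injD)
    qed
  qed
qed

text \<open>On the affine range, \<omega> \<bullet> y has the constant value \<omega> \<bullet> a.
  With nonnegative summands this bounds each coordinate, so the set is an affine subspace cut by a
  box.\<close>

lemma polytope_of_positive_relation:
  fixes L :: "'a::real_vector \<Rightarrow> real^'e::finite" and a \<omega> :: "real^'e"
  assumes "linear L" and rel: "\<And>z. \<omega> \<bullet> L z = 0" and pos: "\<And>l. \<omega> $ l > 0"
  shows "polytope {y \<in> range (\<lambda>z. L z + a). 0 \<le> y}"
proof -
  let ?b = "\<chi> l. (\<omega> \<bullet> a) / \<omega> $ l"
  have bound: "y $ l \<le> (\<omega> \<bullet> a) / \<omega> $ l" if y: "y \<in> range (\<lambda>z. L z + a)" "0 \<le> y" for y l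
  proof -
    have "\<omega> $ l * y $ l \<le> (\<Sum>l\<in>UNIV. \<omega> $ l * y $ l)"
      using y(2) pos by (intro member_le_sum) (auto simp: less_eq_vec_def less_imp_le)
    also have "\<dots> = \<omega> \<bullet> y" by (simp add: inner_vec_def)
    also have "\<dots> = \<omega> \<bullet> a" using y(1) rel by (auto simp: inner_add_right)
    finally show ?thesis using pos by (simp add: field_simps)
  qed
  have "{y \<in> range (\<lambda>z. L z + a). 0 \<le> y} = range (\<lambda>z. L z + a) \<inter> cbox 0 ?b"
  proof (intro equalityI subsetI)
    fix y assume "y \<in> {y \<in> range (\<lambda>z. L z + a). 0 \<le> y}"
    then have y: "y \<in> range (\<lambda>z. L z + a)" "0 \<le> y" by simp_all
    then have "y \<in> cbox 0 ?b" using bound[OF y] by (simp add: mem_box_cart less_eq_vec_def)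
    with y(1) show "y \<in> range (\<lambda>z. L z + a) \<inter> cbox 0 ?b" by blast
  next
    fix y assume y: "y \<in> range (\<lambda>z. L z + a) \<inter> cbox 0 ?b"
    then have "0 \<le> y" by (simp add: mem_box_cart less_eq_vec_def)
    with y show "y \<in> {y \<in> range (\<lambda>z. L z + a). 0 \<le> y}" by blast
  qed
  moreover have "range (\<lambda>z. L z + a) = (+) a ` range L" by (auto simp: add.commute)
  then have "affine (range (\<lambda>z. L z + a))"
    using linear_subspace_image[OF \<open>linear L\<close> subspace_UNIV]
    by (simp only: affine_translation[symmetric] subspace_imp_affine)
  ultimately show ?thesis
    by (simp only: Int_commute[of _ "cbox 0 _"] polytope_Int_polyhedron polytope_interval
        affine_imp_polyhedron)
qed

section \<open>Plane geometry of triangles\<close>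

text \<open>The determinant with columns \<open>v\<close> and \<open>w\<close>; its sign tells on
  which side of the line along \<open>v\<close> the vector \<open>w\<close> lies.\<close>

definition cross2 :: "real^2 \<Rightarrow> real^2 \<Rightarrow> real" where
  "cross2 v w = v$1 * w$2 - v$2 * w$1"

text \<open>The counterclockwise rotation by a right angle, which is the negative of
  \<open>Kmat\<close>. Its multiples are the infinitesimal rotations.\<close>

definition quarter_turn :: "real^2 \<Rightarrow> real^2" where
  "quarter_turn v = vector [- v$2, v$1]"

lemma inner_real2: "(v::real^2) \<bullet> w = v$1 * w$1 + v$2 * w$2"
  by (simp add: inner_vec_def sum_2)

lemma quarter_turn_nth [simp]: "quarter_turn v $ 1 = - v$2" "quarter_turn v $ 2 = v$1"
  by (simp_all add: quarter_turn_def)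

lemma linear_quarter_turn: "linear quarter_turn"
  by (rule linearI) (simp_all add: vec_eq_iff forall_2)

lemma cross2_zero [simp]: "cross2 v 0 = 0"
  and cross2_self [simp]: "cross2 v v = 0"
  and cross2_scaleR [simp]: "cross2 v (r *\<^sub>R w) = r * cross2 v w"
  and cross2_add: "cross2 v (w + w') = cross2 v w + cross2 v w'"
  and cross2_diff: "cross2 v (w - w') = cross2 v w - cross2 v w'"
  by (simp_all add: cross2_def algebra_simps)

lemma cross2_swap: "cross2 w v = - cross2 v w"
  by (simp add: cross2_def)

lemma cross2_quarter_turn: "cross2 v (quarter_turn v) = v \<bullet> v"
  by (simp add: cross2_def inner_real2)

lemma Lagrange_cross2: "(cross2 v w)\<^sup>2 + (v \<bullet> w)\<^sup>2 = (v \<bullet> v) * (w \<bullet> w)"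
  by (simp add: cross2_def inner_real2 power2_eq_square algebra_simps)

text \<open>In the orthogonal basis \<open>v\<close>, \<open>quarter_turn v\<close>, the second
  coordinate of \<open>w\<close> is proportional to \<open>cross2 v w\<close>.\<close>

lemma cross2_eq_0_imp_scaleR:
  assumes "v \<noteq> 0" "cross2 v w = 0"
  shows "w = (v \<bullet> w / (v \<bullet> v)) *\<^sub>R v"
proof -
  have "(v \<bullet> v) *\<^sub>R w = (v \<bullet> w) *\<^sub>R v + cross2 v w *\<^sub>R quarter_turn v"
    by (simp add: vec_eq_iff forall_2 cross2_def inner_real2 algebra_simps)
  then have "(1 / (v \<bullet> v)) *\<^sub>R ((v \<bullet> v) *\<^sub>R w) = (1 / (v \<bullet> v)) *\<^sub>R ((v \<bullet> w) *\<^sub>R v)"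
    by (simp add: assms(2))
  with assms(1) show ?thesis by simp
qed

lemma orthogonal_imp_quarter_turn:
  assumes "v \<noteq> 0" "w \<bullet> v = 0"
  obtains r where "w = r *\<^sub>R quarter_turn v"
proof -
  have "cross2 (quarter_turn v) w = 0" "quarter_turn v \<noteq> 0"
    using assms by (auto simp: cross2_def inner_real2 vec_eq_iff forall_2 algebra_simps)
  from cross2_eq_0_imp_scaleR[OF this(2,1)] show ?thesis using that by blast
qed

lemma cross2_eq_0_imp_collinear:
  assumes "cross2 (b - a) (c - a) = 0"
  shows "collinear {a, b, c}"
proof (cases "b = a")
  case False
  with assms have "\<exists>r. c - a = r *\<^sub>R (b - a)"
    using cross2_eq_0_imp_scaleR[of "b - a" "c - a"] by auto
  then have "collinear {0, b - a, c - a}"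
    unfolding collinear_lemma by blast
  then have "collinear {b, a, c}" by (simp add: collinear_3)
  then show ?thesis by (simp add: insert_commute)
qed simp

text \<open>\<open>b\<close> and \<open>c\<close> are two sides with a common end, \<open>u\<close> and \<open>w\<close> the displacements of their other ends
  relative to that of the common one.\<close>

lemma infinitesimal_motion_triangle:
  fixes b c u w :: "real^2"
  assumes "cross2 b c \<noteq> 0" "u \<bullet> b = 0" "w \<bullet> c = 0" "(w - u) \<bullet> (c - b) = 0"
  obtains r where "u = r *\<^sub>R quarter_turn b" "w = r *\<^sub>R quarter_turn c"
proof -
  have "b \<noteq> 0" "c \<noteq> 0" using assms(1) by (auto simp: cross2_def)
  then obtain r s where rs: "u = r *\<^sub>R quarter_turn b" "w = s *\<^sub>R quarter_turn c"
    using assms orthogonal_imp_quarter_turn by metis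
  \<comment> \<open>Each end turns about the common vertex with its own angular velocity; the third
    side forces the two velocities to agree.\<close>
  have "(s - r) * cross2 b c = 0"
    using assms(4) unfolding rs by (simp add: inner_real2 cross2_def algebra_simps)
  then have "s = r" using assms(1) by simp
  with rs that show ?thesis by blast
qed

text \<open>Heron's formula for sides that are pairwise sums of the radii: the semiperimeter is
  \<open>sum rad T\<close> and the squared area is \<open>sum rad T * prod rad T\<close>; the
  inradius is area over semiperimeter.\<close>

definition inradius :: "('v \<Rightarrow> real) \<Rightarrow> 'v set \<Rightarrow> real" where
  "inradius rad T = sqrt (prod rad T / sum rad T)"

text \<open>\<open>b\<close> and \<open>c\<close> are the sides at the centre of the disk of radius \<open>r1\<close> in the triangle spanned by
  three mutually tangent disks, and the square root is its inradius. The incircle touches the sides at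
  the contact points, so the inradius is \<open>r1\<close> times the tangent of half the angle between \<open>b\<close> and
  \<open>c\<close>.\<close>

lemma tangent_disks_incircle:
  fixes b c :: "real^2"
  assumes pos: "r1 > 0" "r2 > 0" "r3 > 0"
    and len: "norm b = r1 + r2" "norm c = r1 + r3" "norm (c - b) = r2 + r3"
  shows "sqrt (r1 * r2 * r3 / (r1 + r2 + r3)) *\<^sub>R (b /\<^sub>R norm b + c /\<^sub>R norm c) =
     (r1 * sgn (cross2 b c)) *\<^sub>R quarter_turn (b /\<^sub>R norm b - c /\<^sub>R norm c)"
    (is "?\<rho> *\<^sub>R _ = _")
proof -
  define C where "C = cross2 b c"
  define s where "s = r1 + r2 + r3"
  have bb: "b \<bullet> b = (r1 + r2)\<^sup>2" and cc: "c \<bullet> c = (r1 + r3)\<^sup>2"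
    using len by (simp_all add: dot_square_norm)
  have "(c - b) \<bullet> (c - b) = (r2 + r3)\<^sup>2" using len(3) by (simp add: dot_square_norm)
  then have bc: "b \<bullet> c = r1 * s - r2 * r3"
    using bb cc by (simp add: inner_simps inner_commute power2_eq_square algebra_simps s_def)
  have s: "s > 0" using pos by (simp add: s_def)
  \<comment> \<open>Heron's formula, since \<open>C\<close> is twice the signed area.\<close>
  have C2: "C\<^sup>2 = 4 * r1 * r2 * r3 * s"
    using Lagrange_cross2[of b c] unfolding bb cc bc C_def[symmetric]
    by (simp add: power2_eq_square s_def algebra_simps)
  then have "C \<noteq> 0" using pos s by auto
  have \<rho>: "?\<rho> = \<bar>C\<bar> / (2 * s)"
  proof (rule real_sqrt_unique)
    show "(\<bar>C\<bar> / (2 * s))\<^sup>2 = r1 * r2 * r3 / (r1 + r2 + r3)"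
      using s C2 by (simp add: power_divide power2_eq_square flip: s_def)
  qed (use s in simp)
  have key: "?\<rho> = sgn C * C / (2 * s)" unfolding \<rho> by (simp add: abs_sgn mult.commute)
  \<comment> \<open>The difference of the two sides is tested against \<open>b\<close> and
    \<open>c\<close>, which span the plane because \<open>C\<close> is nonzero.\<close>
  define e where "e = ?\<rho> *\<^sub>R (b /\<^sub>R norm b + c /\<^sub>R norm c) -
     (r1 * sgn C) *\<^sub>R quarter_turn (b /\<^sub>R norm b - c /\<^sub>R norm c)"
  have qtb: "quarter_turn (b /\<^sub>R norm b - c /\<^sub>R norm c) =
      quarter_turn b /\<^sub>R norm b - quarter_turn c /\<^sub>R norm c"
    by (simp add: linear_diff[OF linear_quarter_turn] linear_cmul[OF linear_quarter_turn])
  have qi: "quarter_turn b \<bullet> c = C" "quarter_turn c \<bullet> b = - C" "quarter_turn b \<bullet> b = 0"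
      "quarter_turn c \<bullet> c = 0"
    by (simp_all add: C_def cross2_def inner_real2)
  have len0: "norm b > 0" "norm c > 0" using pos len by simp_all
  \<comment> \<open>The half-angle identity 1 + cos t = 2 cos^2 (t/2), multiplied by the two side
    lengths.\<close>
  have half_angle: "norm b * norm c + b \<bullet> c = 2 * (r1 * s)"
    unfolding len bc by (simp add: s_def algebra_simps)
  have bb': "b \<bullet> b = norm b * norm b" and cc': "c \<bullet> c = norm c * norm c"
    by (simp_all add: dot_square_norm power2_eq_square)
  have "e \<bullet> b = sgn C * C / (2 * s * norm c) * (norm b * norm c + b \<bullet> c - 2 * (r1 * s))"
    unfolding e_def key qtb inner_diff_left inner_scaleR_left inner_add_left qi bb'
      inner_commute[of c b] using len0 s by (simp add: field_simps)
  moreover have "e \<bullet> c = sgn C * C / (2 * s * norm b) * (norm b * norm c + b \<bullet> c - 2 * (r1 * s))"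
    unfolding e_def key qtb inner_diff_left inner_scaleR_left inner_add_left qi cc'
    using len0 s by (simp add: field_simps)
  ultimately have "e \<bullet> b = 0" "e \<bullet> c = 0" by (simp_all add: half_angle)
  have "C *\<^sub>R e = - (e \<bullet> b) *\<^sub>R quarter_turn c + (e \<bullet> c) *\<^sub>R quarter_turn b"
    by (simp add: vec_eq_iff forall_2 C_def cross2_def inner_real2 algebra_simps)
  with \<open>e \<bullet> b = 0\<close> \<open>e \<bullet> c = 0\<close> \<open>C \<noteq> 0\<close> have "e = 0" by simp
  then show ?thesis by (simp add: e_def C_def)
qed

section \<open>Triangulations and their equilibrium stress\<close>

locale planar_triangulation =
  fixes x :: "'v::finite \<Rightarrow> real^2" and \<tau> :: "'v set set"
  assumes inj: "inj x"
    and card_triangle: "T \<in> \<tau> \<Longrightarrow> card T = 3"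
    and nondegenerate: "T \<in> \<tau> \<Longrightarrow> \<not> collinear (x ` T)"
    and triangulation: "triangulation ((\<lambda>T. convex hull (x ` T)) ` \<tau>)"
begin

section \<open>Triangles sharing an edge\<close>

lemma hull_Int_face:
  assumes "T \<in> \<tau>" "T' \<in> \<tau>"
  shows "(convex hull (x ` T) \<inter> convex hull (x ` T')) face_of (convex hull (x ` T))"
  using triangulation assms by (auto simp: triangulation_def)

lemma third_vertex:
  assumes "T \<in> \<tau>" "i \<in> T" "j \<in> T" "i \<noteq> j"
  obtains k where "T = {i, j, k}" "k \<noteq> i" "k \<noteq> j" "cross2 (x j - x i) (x k - x i) \<noteq> 0"
proof -
  obtain a b c where abc: "T = {a, b, c}" "a \<noteq> b" "b \<noteq> c" "a \<noteq> c"
    using card_triangle[OF assms(1)] by (auto simp: card_3_iff)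
  with assms(2-4) obtain k where k: "T = {i, j, k}" "k \<noteq> i" "k \<noteq> j" by auto
  have "cross2 (x j - x i) (x k - x i) \<noteq> 0"
    using cross2_eq_0_imp_collinear[of "x j" "x i" "x k"] nondegenerate[OF assms(1)] k(1) by auto
  with k that show ?thesis by blast
qed

lemma affine_independent_triangle:
  assumes "T \<in> \<tau>"
  shows "\<not> affine_dependent (x ` T)"
proof -
  obtain a b c where "T = {a, b, c}"
    using card_triangle[OF assms] by (auto simp: card_3_iff)
  with nondegenerate[OF assms] show ?thesis
    by (simp add: collinear_3_eq_affine_dependent)
qed

text \<open>A vertex of one triangle lying in another is an extreme point of their common face,
  hence of the other triangle, whose extreme points are its vertices.\<close>

lemma vertex_in_hull:
  assumes "T \<in> \<tau>" "T' \<in> \<tau>" "k \<in> T" "x k \<in> convex hull (x ` T')"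
  shows "k \<in> T'"
proof -
  let ?F = "convex hull (x ` T) \<inter> convex hull (x ` T')"
  have "{x k} face_of (convex hull (x ` T))"
    using affine_independent_triangle[OF assms(1)] assms(3)
    by (simp add: face_of_singleton extreme_point_of_convex_hull_affine_independent)
  then have "{x k} face_of ?F"
    using assms(3,4) by (rule_tac face_of_subset) (auto intro: hull_inc)
  also have "?F face_of (convex hull (x ` T'))"
    using hull_Int_face[OF assms(2,1)] by (simp add: Int_commute)
  finally have "x k \<in> x ` T'"
    by (auto simp: face_of_singleton intro: extreme_point_of_convex_hull)
  with inj show ?thesis by (auto dest: injD)
qed

text \<open>The factor \<open>w\<close> is the barycentric coordinate at \<open>x k\<close>: no
  point of the triangle lies beyond the line through \<open>x i\<close> and
  \<open>x j\<close>.\<close>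

lemma cross2_convex_hull_3:
  assumes "p \<in> convex hull {x i, x j, x k}"
  obtains w where "w \<ge> 0" "cross2 (x j - x i) (p - x i) = w * cross2 (x j - x i) (x k - x i)"
proof -
  obtain u w where "w \<ge> 0" and p: "p = x i + u *\<^sub>R (x j - x i) + w *\<^sub>R (x k - x i)"
    using assms unfolding convex_hull_3_alt by auto
  have "p - x i = u *\<^sub>R (x j - x i) + w *\<^sub>R (x k - x i)" by (simp add: p)
  then have "cross2 (x j - x i) (p - x i) = w * cross2 (x j - x i) (x k - x i)"
    by (simp add: cross2_add)
  with \<open>w \<ge> 0\<close> that show ?thesis by blast
qed

text \<open>Two triangles on the same side of an edge share a point off its line. Their common face
  then has to contain the vertex \<open>x k\<close>.\<close>

lemma triangle_on_side_unique:
  assumes T: "{i, j, k} \<in> \<tau>" "{i, j, k'} \<in> \<tau>"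
    and same: "cross2 (x j - x i) (x k - x i) * cross2 (x j - x i) (x k' - x i) > 0"
  shows "k = k'"
proof -
  define b where "b = x j - x i"
  define L where "L = cross2 b"
  \<comment> \<open>The ratio of the distances of \<open>x k\<close> and \<open>x k'\<close> from
    the line: \<open>x k - m\<close> and \<open>\<beta> *\<^sub>R (x k' - m)\<close> then differ by
    a multiple of \<open>b\<close>.\<close>
  define \<beta> where "\<beta> = L (x k - x i) / L (x k' - x i)"
  have L: "L (x k - x i) \<noteq> 0" "L (x k' - x i) \<noteq> 0" "\<beta> > 0"
    using same by (auto simp: L_def b_def \<beta>_def zero_less_mult_iff zero_less_divide_iff)
  have "b \<noteq> 0" using L(1) by (auto simp: L_def cross2_def)
  define m where "m = x i + (1/2) *\<^sub>R b"
  have Lm: "L (y - m) = L (y - x i)" for y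
  proof -
    have "y - m = (y - x i) - (1/2) *\<^sub>R b" by (simp add: m_def)
    then show ?thesis unfolding L_def by (simp only: cross2_diff[of b "y - x i"]) simp
  qed
  have "L (x k - m - \<beta> *\<^sub>R (x k' - m)) = L (x k - m) - \<beta> * L (x k' - m)"
    by (simp only: L_def cross2_diff[of _ "x k - m"] cross2_scaleR)
  also have "\<dots> = 0" using L by (simp add: Lm \<beta>_def)
  finally obtain \<alpha> where \<alpha>: "x k - m - \<beta> *\<^sub>R (x k' - m) = \<alpha> *\<^sub>R b"
    using cross2_eq_0_imp_scaleR[OF \<open>b \<noteq> 0\<close>] unfolding L_def by blast
  \<comment> \<open>Small enough for the barycentric coordinates of \<open>p\<close> to be
    nonnegative in both triangles.\<close>
  define s where "s = 1 / (2 * (1 + \<bar>\<alpha>\<bar> + \<beta>))"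
  have "s * (1 + \<bar>\<alpha>\<bar> + \<beta>) = 1/2" "0 < s" "s \<le> 1"
    using L(3) by (auto simp: s_def field_simps)
  then have s: "0 < s" "s \<le> 1" "s * \<bar>\<alpha>\<bar> + s * \<beta> \<le> 1/2"
    by (simp_all add: distrib_left)
  define p where "p = m + s *\<^sub>R (x k - m)"
  have "p = x i + (1/2 - s/2) *\<^sub>R (x j - x i) + s *\<^sub>R (x k - x i)"
    by (simp add: p_def m_def b_def algebra_simps)
  then have pT: "p \<in> convex hull (x ` {i, j, k})"
    using s unfolding image_insert image_empty convex_hull_3_alt
    by (intro CollectI exI[of _ "1/2 - s/2"] exI[of _ s]) auto
  have "p = m + s *\<^sub>R (\<alpha> *\<^sub>R b + \<beta> *\<^sub>R (x k' - m))"
    by (simp add: p_def flip: \<alpha>)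
  also have "\<dots> = x i + (1/2 + s * \<alpha> - s * \<beta> / 2) *\<^sub>R (x j - x i) + (s * \<beta>) *\<^sub>R (x k' - x i)"
    by (simp add: m_def b_def algebra_simps)
  finally have "p = \<dots>" .
  moreover have "\<bar>s * \<alpha>\<bar> + s * \<beta> \<le> 1/2" "s * \<beta> > 0" using s L(3) by (simp_all add: abs_mult)
  then have "0 \<le> 1/2 + s * \<alpha> - s * \<beta> / 2" "0 \<le> s * \<beta>" "1/2 + s * \<alpha> - s * \<beta> / 2 + s * \<beta> \<le> 1"
    by linarith+
  ultimately have pT': "p \<in> convex hull (x ` {i, j, k'})"
    unfolding image_insert image_empty convex_hull_3_alt by blast
  obtain C where C: "C \<subseteq> x ` {i, j, k}"
      "convex hull (x ` {i, j, k}) \<inter> convex hull (x ` {i, j, k'}) = convex hull C"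
    using hull_Int_face[OF T] face_of_convex_hull_affine_independent[OF affine_independent_triangle[OF T(1)]]
    by blast
  have "x k \<in> C"
  proof (rule ccontr)
    assume "x k \<notin> C"
    \<comment> \<open>The edge is written as a degenerate triangle so that
      \<open>cross2_convex_hull_3\<close> applies to it.\<close>
    then have "C \<subseteq> {x i, x j, x i}" using C(1) by auto
    then have "p \<in> convex hull {x i, x j, x i}" using pT pT' C(2) hull_mono by blast
    then have "L (p - x i) = 0"
      by (rule cross2_convex_hull_3) (simp add: L_def b_def)
    moreover have "L (p - m) = s * L (x k - m)" by (simp add: p_def L_def)
    ultimately show False using s(1) L by (simp add: Lm)
  qed
  then have "x k \<in> convex hull (x ` {i, j, k'})"
    using C(2) hull_inc by fast
  then have "k \<in> {i, j, k'}"
    using vertex_in_hull[OF T] by blast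
  moreover have "k \<noteq> i" "k \<noteq> j" using L(1) by (auto simp: L_def b_def)
  ultimately show ?thesis by blast
qed

text \<open>A small step from the midpoint, perpendicular to the edge, stays in the triangulated
  region; the triangle reached also contains the midpoint and therefore the whole edge. The sign of
  \<open>e\<close> selects the side.\<close>

lemma triangle_on_side_exists:
  assumes T: "T \<in> \<tau>" "i \<in> T" "j \<in> T" "i \<noteq> j" and "e \<noteq> 0"
    and int: "midpoint (x i) (x j) \<in> interior (\<Union>T\<in>\<tau>. convex hull (x ` T))"
  obtains k where "{i, j, k} \<in> \<tau>" "e * cross2 (x j - x i) (x k - x i) > 0"
proof -
  define m where "m = midpoint (x i) (x j)"
  define b where "b = x j - x i"
  have "b \<noteq> 0" using inj \<open>i \<noteq> j\<close> by (auto simp: b_def dest: injD)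
  \<comment> \<open>The triangles missing \<open>m\<close> form a closed set, so a small ball around
    \<open>m\<close> avoids them all.\<close>
  define C where "C = (\<Union>T\<in>{T\<in>\<tau>. m \<notin> convex hull (x ` T)}. convex hull (x ` T))"
  have "closed C"
    unfolding C_def by (intro closed_UN ballI compact_imp_closed compact_convex_hull finite_imp_compact) auto
  then have "open (interior (\<Union>T\<in>\<tau>. convex hull (x ` T)) - C)" by (intro open_Diff) auto
  moreover have "m \<in> interior (\<Union>T\<in>\<tau>. convex hull (x ` T)) - C"
    using int by (auto simp: m_def C_def)
  ultimately obtain r where r: "r > 0" "ball m r \<subseteq> interior (\<Union>T\<in>\<tau>. convex hull (x ` T)) - C"
    using open_contains_ball by blast
  define n where "n = e *\<^sub>R quarter_turn b"
  define t where "t = r / (2 * (1 + norm n))"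
  have t: "t > 0" using r(1) by (simp add: t_def add_pos_nonneg)
  have "t * norm n < r"
    using r(1) by (simp add: t_def field_simps add_pos_nonneg add_nonneg_pos)
  define p where "p = m + t *\<^sub>R n"
  have "p \<in> ball m r" using \<open>t * norm n < r\<close> t by (simp add: p_def dist_norm)
  then have "p \<in> (\<Union>T\<in>\<tau>. convex hull (x ` T))" "p \<notin> C"
    using r(2) interior_subset by blast+
  then obtain T' where T': "T' \<in> \<tau>" "p \<in> convex hull (x ` T')" "m \<in> convex hull (x ` T')"
    by (auto simp: C_def)
  have hullT: "x i \<in> convex hull (x ` T)" "x j \<in> convex hull (x ` T)"
    using T by (auto intro: hull_inc)
  have m_seg: "m \<in> open_segment (x i) (x j)"
    using inj \<open>i \<noteq> j\<close> by (auto simp: m_def dest: injD)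
  have "m \<in> convex hull (x ` T)"
    using m_seg hullT convex_contains_open_segment[of "convex hull (x ` T)"] by (auto simp: convex_convex_hull)
  \<comment> \<open>A face containing a relatively interior point of a segment in the hull contains
    both ends.\<close>
  then have "x i \<in> convex hull (x ` T')" "x j \<in> convex hull (x ` T')"
    using hull_Int_face[OF T(1) T'(1)] T'(3) m_seg hullT unfolding face_of_def by blast+
  then have "i \<in> T'" "j \<in> T'" using vertex_in_hull[OF T(1) T'(1)] T by auto
  then obtain k where k: "T' = {i, j, k}"
    using third_vertex[OF T'(1) _ _ \<open>i \<noteq> j\<close>] by metis
  obtain w where w: "w \<ge> 0" "cross2 b (p - x i) = w * cross2 b (x k - x i)"
    using T'(2) cross2_convex_hull_3[of p i j k] by (auto simp: k b_def)
  have "m - x i = (1/2) *\<^sub>R b"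
    by (simp add: m_def midpoint_def b_def vec_eq_iff field_simps)
  then have "p - x i = (1/2) *\<^sub>R b + (t * e) *\<^sub>R quarter_turn b"
    by (simp add: p_def n_def add_diff_eq[symmetric] add.commute[of m])
  then have "e * cross2 b (p - x i) = t * (e * e) * (b \<bullet> b)"
    by (simp add: cross2_add cross2_quarter_turn)
  also have "\<dots> > 0" using t \<open>e \<noteq> 0\<close> \<open>b \<noteq> 0\<close> by (auto intro!: mult_pos_pos simp: zero_less_mult_iff)
  finally have "0 < w * (e * cross2 b (x k - x i))" by (simp add: w(2) mult_ac)
  with w(1) have "e * cross2 b (x k - x i) > 0" by (simp add: zero_less_mult_iff)
  with T'(1) k that show ?thesis by (simp add: b_def)
qed

text \<open>The sum has one term, the third vertex of \<open>T\<close>.\<close>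

definition side :: "'v set \<Rightarrow> 'v \<Rightarrow> 'v \<Rightarrow> real" where
  "side T i j = (\<Sum>k\<in>T - {i, j}. sgn (cross2 (x j - x i) (x k - x i)))"

lemma side_eq:
  assumes "k \<noteq> i" "k \<noteq> j"
  shows "side {i, j, k} i j = sgn (cross2 (x j - x i) (x k - x i))"
proof -
  have "{i, j, k} - {i, j} = {k}" using assms by auto
  then show ?thesis by (simp add: side_def)
qed

text \<open>An interior edge has exactly one triangle on each side, and their signs cancel.\<close>

lemma sum_side_eq_0:
  assumes T: "T \<in> \<tau>" "i \<in> T" "j \<in> T" "i \<noteq> j"
    and int: "midpoint (x i) (x j) \<in> interior (\<Union>T\<in>\<tau>. convex hull (x ` T))"
  shows "(\<Sum>T | T \<in> \<tau> \<and> i \<in> T \<and> j \<in> T. side T i j) = 0"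
proof -
  let ?C = "\<lambda>k. cross2 (x j - x i) (x k - x i)"
  obtain k1 where k1: "{i, j, k1} \<in> \<tau>" "?C k1 > 0"
    using triangle_on_side_exists[OF T _ int, of 1] by auto
  obtain k2 where k2: "{i, j, k2} \<in> \<tau>" "?C k2 < 0"
    using triangle_on_side_exists[OF T _ int, of "-1"] by auto
  have "?C i = 0" "?C j = 0" by simp_all
  with k1(2) k2(2) have ne: "k1 \<noteq> i" "k1 \<noteq> j" "k2 \<noteq> i" "k2 \<noteq> j" "k1 \<noteq> k2" by fastforce+
  have "{T. T \<in> \<tau> \<and> i \<in> T \<and> j \<in> T} = {{i, j, k1}, {i, j, k2}}"
  proof (intro equalityI subsetI)
    fix T' assume "T' \<in> {T. T \<in> \<tau> \<and> i \<in> T \<and> j \<in> T}"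
    then obtain k where k: "T' = {i, j, k}" "?C k \<noteq> 0" "T' \<in> \<tau>"
      using third_vertex[of T' i j] \<open>i \<noteq> j\<close> by auto
    then have "?C k * ?C k1 > 0 \<or> ?C k * ?C k2 > 0"
      using k1(2) k2(2) by (auto simp: zero_less_mult_iff)
    then have "k = k1 \<or> k = k2"
      using triangle_on_side_unique k1(1) k2(1) k(1,3) by metis
    with k(1) show "T' \<in> {{i, j, k1}, {i, j, k2}}" by auto
  qed (use k1 k2 in auto)
  moreover have "{i, j, k1} \<noteq> {i, j, k2}" using ne by auto
  moreover have "side {i, j, k1} i j = 1" "side {i, j, k2} i j = -1"
    unfolding side_eq[OF ne(1,2)] side_eq[OF ne(3,4)] using k1(2) k2(2) by simp_all
  ultimately show ?thesis by (simp only: sum.insert finite.intros sum.empty) auto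
qed

end

section \<open>Stress from inradii and infinitesimal rigidity\<close>

locale contact_triangulation = planar_triangulation x \<tau>
  for x :: "'v::finite \<Rightarrow> real^2" and \<tau> +
  fixes rad :: "'v \<Rightarrow> real"
  assumes rad_pos: "rad i > 0"
    and contact_iff: "contact x rad i j \<longleftrightarrow> i \<noteq> j \<and> (\<exists>T\<in>\<tau>. i \<in> T \<and> j \<in> T)"
begin

lemma inradius_pos:
  assumes "T \<in> \<tau>"
  shows "inradius rad T > 0"
proof -
  have "T \<noteq> {}" using card_triangle[OF assms] by auto
  then have "sum rad T > 0" "prod rad T > 0" by (auto intro!: sum_pos prod_pos rad_pos)
  then show ?thesis by (simp add: inradius_def)
qed

definition stress :: "'v \<Rightarrow> 'v \<Rightarrow> real" where
  "stress i j = (\<Sum>T | T \<in> \<tau> \<and> i \<in> T \<and> j \<in> T. inradius rad T)"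

lemma stress_commute: "stress i j = stress j i"
  unfolding stress_def by (rule sum.cong) auto

lemma stress_pos:
  assumes "contact x rad i j"
  shows "stress i j > 0"
  using assms unfolding stress_def contact_iff by (intro sum_pos) (auto intro: inradius_pos)

text \<open>The right-hand side is what makes the forces of the triangles around \<open>i\<close> telescope: an edge
  at \<open>i\<close> enters with opposite signs from its two sides.\<close>

lemma triangle_force:
  assumes T: "T \<in> \<tau>" "i \<in> T"
  shows "(\<Sum>j\<in>T - {i}. inradius rad T *\<^sub>R qvec x i j) =
         (\<Sum>j\<in>T - {i}. (rad i * side T i j) *\<^sub>R quarter_turn (qvec x i j))"
proof -
  have "card (T - {i}) = 2" using card_triangle[OF T(1)] T(2) by simp
  then obtain j where j: "j \<in> T" "j \<noteq> i"
    by (metis Diff_iff card_2_iff insertI1)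
  obtain k where k: "T = {i, j, k}" "k \<noteq> i" "k \<noteq> j" "cross2 (x j - x i) (x k - x i) \<noteq> 0"
    using third_vertex[OF T(1,2) j(1)] j(2) by metis
  have "k \<in> T" by (simp add: k(1))
  then have "contact x rad i j" "contact x rad i k" "contact x rad j k"
    using T j k(2,3) by (auto simp: contact_iff)
  then have len: "norm (x j - x i) = rad i + rad j" "norm (x k - x i) = rad i + rad k"
      "norm ((x k - x i) - (x j - x i)) = rad j + rad k"
    by (simp_all add: contact_def norm_minus_commute)
  have Ti: "T - {i} = {j, k}" using k j by auto
  have "inradius rad T = sqrt (rad i * rad j * rad k / (rad i + rad j + rad k))"
    unfolding inradius_def k(1) using k(2,3) j(2) by (simp add: mult.assoc add.assoc)
  then have "inradius rad T *\<^sub>R (qvec x i j + qvec x i k) =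
      (rad i * sgn (cross2 (x j - x i) (x k - x i))) *\<^sub>R quarter_turn (qvec x i j - qvec x i k)"
    using tangent_disks_incircle[OF rad_pos rad_pos rad_pos len] by (simp add: qvec_def)
  moreover have "side T i j = sgn (cross2 (x j - x i) (x k - x i))"
    unfolding k(1) by (rule side_eq[OF k(2,3)])
  moreover have "side T i k = - sgn (cross2 (x j - x i) (x k - x i))"
    using side_eq[of j i k] j(2) k(3) unfolding k(1)
    by (simp add: insert_commute cross2_swap[of "x k - x i"] sgn_minus)
  ultimately show ?thesis
    using k(3) unfolding Ti
    by (simp add: linear_diff[OF linear_quarter_turn] algebra_simps)
qed

text \<open>Regroup the force at \<open>i\<close> by triangles, apply \<open>triangle_force\<close>,
  and regroup by edges: every edge at \<open>i\<close> is interior, so its coefficient vanishes by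
  \<open>sum_side_eq_0\<close>.\<close>

lemma equilibrium:
  assumes int: "\<And>j. contact x rad i j \<Longrightarrow>
      midpoint (x i) (x j) \<in> interior (\<Union>T\<in>\<tau>. convex hull (x ` T))"
  shows "(\<Sum>j\<in>nbrs x rad i. stress i j *\<^sub>R qvec x i j) = 0"
proof -
  have swap: "(\<Sum>j\<in>nbrs x rad i. \<Sum>T | T \<in> \<tau> \<and> i \<in> T \<and> j \<in> T. f T j) =
      (\<Sum>T | T \<in> \<tau> \<and> i \<in> T. \<Sum>j\<in>T - {i}. f T j)" for f :: "'v set \<Rightarrow> 'v \<Rightarrow> real^2"
  proof -
    have "(\<Sum>T | T \<in> \<tau> \<and> i \<in> T. \<Sum>j\<in>T - {i}. f T j) =
        (\<Sum>T | T \<in> \<tau> \<and> i \<in> T. \<Sum>j | j \<in> nbrs x rad i \<and> j \<in> T. f T j)"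
      by (intro sum.cong refl) (auto simp: nbrs_def contact_iff)
    also have "\<dots> = (\<Sum>j\<in>nbrs x rad i. \<Sum>T | T \<in> {T. T \<in> \<tau> \<and> i \<in> T} \<and> j \<in> T. f T j)"
      by (rule sum.swap_restrict) auto
    finally show ?thesis by (simp add: conj_assoc)
  qed
  have "(\<Sum>j\<in>nbrs x rad i. stress i j *\<^sub>R qvec x i j) =
      (\<Sum>T | T \<in> \<tau> \<and> i \<in> T. \<Sum>j\<in>T - {i}. inradius rad T *\<^sub>R qvec x i j)"
    unfolding stress_def scaleR_left.sum by (rule swap)
  also have "\<dots> = (\<Sum>T | T \<in> \<tau> \<and> i \<in> T. \<Sum>j\<in>T - {i}. (rad i * side T i j) *\<^sub>R quarter_turn (qvec x i j))"
    by (intro sum.cong refl triangle_force) auto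
  also have "\<dots> = (\<Sum>j\<in>nbrs x rad i. (rad i * (\<Sum>T | T \<in> \<tau> \<and> i \<in> T \<and> j \<in> T. side T i j))
      *\<^sub>R quarter_turn (qvec x i j))"
    unfolding sum_distrib_left scaleR_left.sum by (rule swap[symmetric])
  also have "\<dots> = 0"
  proof (intro sum.neutral ballI)
    fix j assume j: "j \<in> nbrs x rad i"
    then obtain T where "T \<in> \<tau>" "i \<in> T" "j \<in> T" "i \<noteq> j"
      by (auto simp: nbrs_def contact_iff)
    with sum_side_eq_0[OF this int] j
    show "(rad i * (\<Sum>T | T \<in> \<tau> \<and> i \<in> T \<and> j \<in> T. side T i j)) *\<^sub>R quarter_turn (qvec x i j) = 0"
      by (simp add: nbrs_def)
  qed
  finally show ?thesis .
qed

text \<open>Each triangle moves as a rigid body to first order, and two rigid motions that agree at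
  two distinct points coincide, so the motions glue along the construction.\<close>

lemma rigid_on_built:
  assumes "triangle_built \<tau> V Es"
    and u: "\<And>i j. contact x rad i j \<Longrightarrow> (u j - u i) \<bullet> (x j - x i) = 0"
  shows "\<exists>c r. \<forall>v\<in>V. u v = c + r *\<^sub>R quarter_turn (x v)"
proof -
  have tri: "\<exists>c r. \<forall>v\<in>T. u v = c + r *\<^sub>R quarter_turn (x v)" if T: "T \<in> \<tau>" for T
  proof -
    obtain i where i: "i \<in> T" using card_triangle[OF T] by (auto simp: card_3_iff)
    have "card (T - {i}) = 2" using card_triangle[OF T] i by simp
    then obtain j where j: "j \<in> T" "i \<noteq> j" by (metis Diff_iff card_2_iff insertI1)
    obtain k where k: "T = {i, j, k}" "k \<noteq> i" "k \<noteq> j" "cross2 (x j - x i) (x k - x i) \<noteq> 0"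
      using third_vertex[OF T i j] by metis
    have "k \<in> T" by (simp add: k(1))
    then have "contact x rad i j" "contact x rad i k" "contact x rad j k"
      using T i j k(2,3) by (auto simp: contact_iff)
    then have "(u j - u i) \<bullet> (x j - x i) = 0" "(u k - u i) \<bullet> (x k - x i) = 0"
        "((u k - u i) - (u j - u i)) \<bullet> ((x k - x i) - (x j - x i)) = 0"
      using u by simp_all
    then obtain r where "u j - u i = r *\<^sub>R quarter_turn (x j - x i)"
        "u k - u i = r *\<^sub>R quarter_turn (x k - x i)"
      using infinitesimal_motion_triangle[OF k(4)] by metis
    then have "\<forall>v\<in>T. u v = (u i - r *\<^sub>R quarter_turn (x i)) + r *\<^sub>R quarter_turn (x v)"
      unfolding k(1) by (auto simp: linear_diff[OF linear_quarter_turn] algebra_simps)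
    then show ?thesis by blast
  qed
  show ?thesis
    using assms(1)
  proof induction
    case (start T)
    then show ?case by (rule tri)
  next
    case (add_vertex V Es T i j)
    obtain c r where cr: "\<And>v. v \<in> V \<Longrightarrow> u v = c + r *\<^sub>R quarter_turn (x v)"
      using add_vertex.IH by blast
    obtain c' r' where cr': "\<And>v. v \<in> T \<Longrightarrow> u v = c' + r' *\<^sub>R quarter_turn (x v)"
      using tri[OF add_vertex.hyps(2)] by blast
    have ij: "i \<in> V" "j \<in> V" "i \<in> T" "j \<in> T" using add_vertex.hyps(3) by blast+
    have "c + r *\<^sub>R quarter_turn (x i) = c' + r' *\<^sub>R quarter_turn (x i)"
        "c + r *\<^sub>R quarter_turn (x j) = c' + r' *\<^sub>R quarter_turn (x j)"
      using cr cr' ij by metis+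
    note eqs = this
    \<comment> \<open>Taking the difference over the two shared vertices eliminates the
      translations.\<close>
    have "(r - r') *\<^sub>R quarter_turn (x j - x i) =
        (c + r *\<^sub>R quarter_turn (x j) - (c' + r' *\<^sub>R quarter_turn (x j))) -
        (c + r *\<^sub>R quarter_turn (x i) - (c' + r' *\<^sub>R quarter_turn (x i)))"
      by (simp add: linear_diff[OF linear_quarter_turn] algebra_simps)
    also have "\<dots> = 0" unfolding eqs by simp
    finally have "(r - r') *\<^sub>R quarter_turn (x j - x i) = 0" .
    moreover have "x i \<noteq> x j" using inj add_vertex.hyps(4) by (auto dest: injD)
    ultimately have "r = r'" by (auto simp: vec_eq_iff forall_2)
    with eqs have "c = c'" by simp
    with cr cr' \<open>r = r'\<close> show ?case by blast
  qed
\<comment> \<open>In the case \<open>add_edge\<close> the vertex set is unchanged, so the goal is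
  the induction hypothesis.\<close>
qed

end

section \<open>Rigidity matrix\<close>

lemma contact_commute: "contact x rad i j \<longleftrightarrow> contact x rad j i"
  by (auto simp: contact_def norm_minus_commute add.commute)

lemma qvec_commute: "qvec x j i = - qvec x i j"
  by (simp add: qvec_def norm_minus_commute flip: scaleR_minus_right)

lemma contact_edges_iff: "{i, j} \<in> contact_edges x rad \<longleftrightarrow> contact x rad i j"
  unfolding contact_edges_def by (auto simp: doubleton_eq_iff contact_commute)

lemma edge_enum_contact:
  assumes "edge_enum x rad src tgt"
  shows "contact x rad (src l) (tgt l)"
  using bij_betwE[OF assms[unfolded edge_enum_def]] by (auto simp: contact_edges_iff)

lemma edge_enum_edge:
  assumes "edge_enum x rad src tgt" "contact x rad i j"
  obtains l where "{src l, tgt l} = {i, j}"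
proof -
  have "{i, j} \<in> (\<lambda>l. {src l, tgt l}) ` UNIV"
    using assms by (simp add: edge_enum_def bij_betw_def contact_edges_iff)
  with that show ?thesis by auto
qed

lemma edge_enum_inj:
  assumes "edge_enum x rad src tgt" "{src l, tgt l} = {src l', tgt l'}"
  shows "l = l'"
  using assms by (auto simp: edge_enum_def bij_betw_def dest: injD)

text \<open>Summation by parts: the transpose of the rigidity matrix sends edge stresses to the
  negative resultant forces at the vertices.\<close>

lemma virtual_work:
  fixes x :: "'v::finite \<Rightarrow> real^2" and \<omega> :: "'v \<Rightarrow> 'v \<Rightarrow> real"
  assumes enum: "edge_enum x rad src tgt" and sym: "\<And>i j. \<omega> i j = \<omega> j i"
  shows "(\<chi> l. \<omega> (src l) (tgt l)) \<bullet> Rr x src tgt U =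
         - (\<Sum>i\<in>UNIV. U $ i \<bullet> (\<Sum>j\<in>nbrs x rad i. \<omega> i j *\<^sub>R qvec x i j))"
proof -
  \<comment> \<open>The contribution of edge \<open>l\<close> to the force at vertex
    \<open>i\<close>, zero unless \<open>i\<close> is an end of \<open>l\<close>.\<close>
  define G where "G i l = (if src l = i then \<omega> i (tgt l) *\<^sub>R qvec x i (tgt l) else 0) +
      (if tgt l = i then \<omega> i (src l) *\<^sub>R qvec x i (src l) else 0)" for i l
  have G: "(\<Sum>l\<in>UNIV. G i l) = (\<Sum>j\<in>nbrs x rad i. \<omega> i j *\<^sub>R qvec x i j)" for i
  proof -
    define opp where "opp l = (if src l = i then tgt l else src l)" for l
    have ne: "src l \<noteq> tgt l" for l
      using edge_enum_contact[OF enum, of l] by (simp add: contact_def)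
    have opp: "{src l, tgt l} = {i, opp l}" if "src l = i \<or> tgt l = i" for l
      using that by (auto simp: opp_def)
    \<comment> \<open>Each edge is enumerated once, so the edges at \<open>i\<close> correspond to
      its neighbours through their other end.\<close>
    have bij: "bij_betw opp {l. src l = i \<or> tgt l = i} (nbrs x rad i)"
    proof (rule bij_betw_imageI)
      show "inj_on opp {l. src l = i \<or> tgt l = i}"
        using opp by (intro inj_onI edge_enum_inj[OF enum]) auto
      show "opp ` {l. src l = i \<or> tgt l = i} = nbrs x rad i"
      proof (intro equalityI subsetI)
        fix j assume "j \<in> opp ` {l. src l = i \<or> tgt l = i}"
        then obtain l where l: "j = opp l" "{src l, tgt l} = {i, j}" using opp by auto
        then show "j \<in> nbrs x rad i"
          using edge_enum_contact[OF enum, of l]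
          by (simp add: nbrs_def flip: contact_edges_iff)
      next
        fix j assume "j \<in> nbrs x rad i"
        then have ij: "contact x rad i j" by (simp add: nbrs_def)
        then obtain l where l: "{src l, tgt l} = {i, j}" by (rule edge_enum_edge[OF enum])
        moreover have "i \<noteq> j" using ij by (simp add: contact_def)
        ultimately have "src l = i \<or> tgt l = i" "opp l = j"
          by (auto simp: doubleton_eq_iff opp_def)
        then show "j \<in> opp ` {l. src l = i \<or> tgt l = i}" by blast
      qed
    qed
    have "(\<Sum>l\<in>UNIV. G i l) = (\<Sum>l | src l = i \<or> tgt l = i. G i l)"
      by (rule sum.mono_neutral_right) (auto simp: G_def)
    also have "\<dots> = (\<Sum>l | src l = i \<or> tgt l = i. \<omega> i (opp l) *\<^sub>R qvec x i (opp l))"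
    proof (intro sum.cong refl)
      fix l assume "l \<in> {l. src l = i \<or> tgt l = i}"
      with ne[of l] show "G i l = \<omega> i (opp l) *\<^sub>R qvec x i (opp l)"
        by (auto simp: G_def opp_def)
    qed
    also have "\<dots> = (\<Sum>j\<in>nbrs x rad i. \<omega> i j *\<^sub>R qvec x i j)"
      by (rule sum.reindex_bij_betw[OF bij])
    finally show ?thesis .
  qed
  have "\<omega> (src l) (tgt l) * Rr x src tgt U $ l = - (\<Sum>i\<in>UNIV. U $ i \<bullet> G i l)" for l
  proof -
    have "(\<Sum>i\<in>UNIV. U $ i \<bullet> G i l) =
        U $ src l \<bullet> (\<omega> (src l) (tgt l) *\<^sub>R qvec x (src l) (tgt l)) +
        U $ tgt l \<bullet> (\<omega> (tgt l) (src l) *\<^sub>R qvec x (tgt l) (src l))"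
      by (simp add: G_def inner_add_right sum.distrib if_distrib[of "inner _"] cong: if_cong)
    then show ?thesis
      by (simp add: Rr_def sym[of "tgt l"] qvec_commute[of x "tgt l"] inner_diff_left algebra_simps)
  qed
  then have "(\<chi> l. \<omega> (src l) (tgt l)) \<bullet> Rr x src tgt U = - (\<Sum>l\<in>UNIV. \<Sum>i\<in>UNIV. U $ i \<bullet> G i l)"
    by (simp add: inner_vec_def sum_negf)
  also have "\<dots> = - (\<Sum>i\<in>UNIV. U $ i \<bullet> (\<Sum>l\<in>UNIV. G i l))"
    by (subst sum.swap) (simp add: inner_sum_right)
  finally show ?thesis by (simp only: G)
qed

lemma linear_Rint:
  fixes x :: "'i::finite + 'b::finite \<Rightarrow> real^2"
  shows "linear (Rint x src tgt)"
proof (rule linearI)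
  fix y z :: "real^2^'i" and r :: real
  have "stack (y + z) (0 :: real^2^'b) = stack y 0 + stack z 0"
      "stack (r *\<^sub>R z) (0 :: real^2^'b) = r *\<^sub>R stack z 0"
    by (simp_all add: stack_def vec_eq_iff split: sum.split)
  moreover have "Rr x src tgt (U + V) = Rr x src tgt U + Rr x src tgt V"
      "Rr x src tgt (r *\<^sub>R U) = r *\<^sub>R Rr x src tgt U" for U V
    by (simp_all add: Rr_def vec_eq_iff inner_simps algebra_simps)
  ultimately show "Rint x src tgt (y + z) = Rint x src tgt y + Rint x src tgt z"
      "Rint x src tgt (r *\<^sub>R z) = r *\<^sub>R Rint x src tgt z"
    by (simp_all add: Rint_def)
qed

lemma contact_triangulationI:
  fixes x :: "'v::finite \<Rightarrow> real^2"
  assumes "disk_packing x rad" "triangulates x rad \<Omega> \<tau>"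
  shows "contact_triangulation x \<tau> rad"
proof
  show "rad i > 0" for i using assms(1) by (simp add: disk_packing_def)
  show "inj x"
  proof (rule injI, rule ccontr)
    fix i j assume "x i = x j" "i \<noteq> j"
    then have "x i \<in> ball (x i) (rad i) \<inter> ball (x j) (rad j)"
      using assms(1) by (simp add: disk_packing_def)
    with \<open>i \<noteq> j\<close> show False using assms(1) unfolding disk_packing_def by blast
  qed
  show "card T = 3" "\<not> collinear (x ` T)" if "T \<in> \<tau>" for T
    using assms(2) that by (auto simp: triangulates_def)
  show "triangulation ((\<lambda>T. convex hull (x ` T)) ` \<tau>)"
    using assms(2) by (simp add: triangulates_def)
  show "contact x rad i j \<longleftrightarrow> i \<noteq> j \<and> (\<exists>T\<in>\<tau>. i \<in> T \<and> j \<in> T)" for i j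
  proof -
    have "contact x rad i j \<longleftrightarrow> {i, j} \<in> (\<Union>T\<in>\<tau>. tri_edges T)"
      using assms(2) by (simp add: triangulates_def contact_edges_iff)
    also have "\<dots> \<longleftrightarrow> i \<noteq> j \<and> (\<exists>T\<in>\<tau>. i \<in> T \<and> j \<in> T)"
      by (cases "i = j") (simp_all add: tri_edges_def)
    finally show ?thesis .
  qed
qed

text \<open>In a convex open set, a segment from a point of the set to a point of its closure stays
  inside except possibly at the far end.\<close>

lemma midpoint_in_interior_triangulation:
  fixes x :: "'i::finite + 'b::finite \<Rightarrow> real^2"
  assumes "polygonal_domain \<Omega>" "triangulates x rad \<Omega> \<tau>" "located_wrt x \<Omega>"
  shows "midpoint (x (Inl i)) (x j) \<in> interior (\<Union>T\<in>\<tau>. convex hull (x ` T))"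
proof -
  have \<Omega>: "open \<Omega>" "convex \<Omega>" using assms(1) by (auto simp: polygonal_domain_def)
  have i: "x (Inl i) \<in> \<Omega>" using assms(3) by (simp add: located_wrt_def)
  have "x j \<in> closure \<Omega>"
    using assms(3) closure_subset[of \<Omega>]
    by (cases j) (auto simp: located_wrt_def frontier_def)
  then have "open_segment (x (Inl i)) (x j) \<subseteq> interior \<Omega>"
    using in_interior_closure_convex_segment[OF \<Omega>(2)] i \<Omega>(1) by (simp add: interior_open)
  then have "midpoint (x (Inl i)) (x j) \<in> interior \<Omega>"
    using i \<Omega>(1) by (cases "x (Inl i) = x j") (auto simp: interior_open)
  also have "interior \<Omega> \<subseteq> interior (closure \<Omega>)" by (intro interior_mono closure_subset)
  also have "closure \<Omega> = (\<Union>T\<in>\<tau>. convex hull (x ` T))"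
    using assms(2) by (simp add: triangulates_def)
  finally show ?thesis .
qed

lemma (in contact_triangulation) motion_eq_0:
  assumes "triangle_built \<tau> UNIV Es"
    and u: "\<And>i j. contact x rad i j \<Longrightarrow> (u j - u i) \<bullet> (x j - x i) = 0"
    and fixed: "u k = 0" "u l = 0" "k \<noteq> l"
  shows "u i = 0"
proof -
  obtain c r where cr: "\<And>v. u v = c + r *\<^sub>R quarter_turn (x v)"
    using rigid_on_built[OF assms(1), of u] u by auto
  have "r *\<^sub>R quarter_turn (x k - x l) = u k - u l"
    by (simp add: cr linear_diff[OF linear_quarter_turn] scaleR_diff_right)
  also have "\<dots> = 0" by (simp add: fixed)
  finally have "r *\<^sub>R quarter_turn (x k - x l) = 0" .
  moreover have "x k \<noteq> x l" using inj fixed(3) by (auto dest: injD)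
  ultimately have "r = 0" by (auto simp: vec_eq_iff forall_2)
  with cr fixed(1) have "c = 0" by simp
  with \<open>r = 0\<close> show ?thesis by (simp add: cr)
qed

lemma Rr_eq_0_edge:
  assumes "edge_enum x rad src tgt" "Rr x src tgt U = 0" "contact x rad i j"
  shows "(U $ j - U $ i) \<bullet> (x j - x i) = 0"
proof -
  obtain l where l: "{src l, tgt l} = {i, j}" using edge_enum_edge[OF assms(1,3)] .
  have "(U $ tgt l - U $ src l) \<bullet> qvec x (src l) (tgt l) = 0"
    using assms(2) by (simp add: Rr_def vec_eq_iff)
  \<comment> \<open>Reversing the orientation of the edge changes the sign of both factors.\<close>
  then have "(U $ j - U $ i) \<bullet> qvec x i j = 0"
    using l unfolding doubleton_eq_iff
    by (elim disjE conjE) (simp_all add: qvec_commute[of x j i] inner_diff_left)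
  then show ?thesis by (auto simp: qvec_def)
qed

text \<open>The hypothesis \<open>rigid\<close> is the vertex property of \<open>z\<close>. A vector
  \<open>w\<close> orthogonal to all active directions at \<open>i\<close> would violate it:
  displacing \<open>i\<close> alone by \<open>w\<close> affects only edges at \<open>i\<close>, and
  the active ones not at all.\<close>

lemma spanning_active_edges:
  fixes x :: "'i::finite + 'b::finite \<Rightarrow> real^2" and src tgt :: "'e::finite \<Rightarrow> 'i + 'b"
  assumes enum: "edge_enum x rad src tgt"
    and rigid: "\<And>h. (\<And>l. active x src tgt a z l \<Longrightarrow> Rint x src tgt h $ l = 0) \<Longrightarrow> h = 0"
  shows "\<exists>l1 l2 j1 j2. l1 \<noteq> l2 \<and>
     {src l1, tgt l1} = {Inl i, j1} \<and> {src l2, tgt l2} = {Inl i, j2} \<and>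
     active x src tgt a z l1 \<and> active x src tgt a z l2 \<and>
     qvec x (Inl i) j1 \<noteq> qvec x (Inl i) j2 \<and>
     independent {qvec x (Inl i) j1, qvec x (Inl i) j2}"
proof -
  define A where
    "A = {qvec x (Inl i) j | j l. {src l, tgt l} = {Inl i, j} \<and> active x src tgt a z l}"
  have "span A = UNIV"
  proof (rule ccontr)
    assume "span A \<noteq> UNIV"
    then obtain w where w: "w \<noteq> 0" "\<And>q. q \<in> A \<Longrightarrow> w \<bullet> q = 0"
      using span_not_UNIV_orthogonal[of A] span_base by blast
    define h :: "real^2^'i" where "h = axis i w"
    have U: "stack h (0 :: real^2^'b) $ v = (if v = Inl i then w else 0)" for v
      by (simp add: stack_def h_def axis_def split: sum.split)
    have "Rint x src tgt h $ l = 0" if l: "active x src tgt a z l" for l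
    proof -
      have ne: "src l \<noteq> tgt l"
        using edge_enum_contact[OF enum, of l] by (simp add: contact_def)
      consider "src l = Inl i" | "tgt l = Inl i" | "src l \<noteq> Inl i" "tgt l \<noteq> Inl i" by blast
      then show ?thesis
      proof cases
        case 1
        then have "{src l, tgt l} = {Inl i, tgt l}" by simp
        with l have "qvec x (Inl i) (tgt l) \<in> A" unfolding A_def by blast
        with 1 ne w(2) show ?thesis by (simp add: Rint_def Rr_def U)
      next
        case 2
        then have "{src l, tgt l} = {Inl i, src l}" by auto
        with l have "qvec x (Inl i) (src l) \<in> A" unfolding A_def by blast
        with 2 ne w(2) show ?thesis
          by (simp add: Rint_def Rr_def U qvec_commute[of x "src l"])
      qed (simp add: Rint_def Rr_def U)
    qed
    then have "h = 0" by (rule rigid)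
    with w(1) show False by (simp add: h_def axis_eq_0_iff)
  qed
  \<comment> \<open>A basis chosen within the active directions has two elements, since they span
    the plane.\<close>
  obtain B where B: "B \<subseteq> A" "independent B" "A \<subseteq> span B" "card B = dim A"
    using basis_exists .
  have "dim A = 2" using dim_span[of A] \<open>span A = UNIV\<close> by simp
  then obtain q1 q2 where q: "B = {q1, q2}" "q1 \<noteq> q2"
    using B(4) by (auto simp: card_2_iff)
  then obtain j1 l1 j2 l2 where
    "q1 = qvec x (Inl i) j1" "{src l1, tgt l1} = {Inl i, j1}" "active x src tgt a z l1"
    "q2 = qvec x (Inl i) j2" "{src l2, tgt l2} = {Inl i, j2}" "active x src tgt a z l2"
    using B(1) by (auto simp: A_def)
  moreover from this q(2) have "l1 \<noteq> l2" by (auto simp: doubleton_eq_iff)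
  ultimately show ?thesis using B(2) q by metis
qed

lemma is_arg_min_objF_iff:
  assumes "d > 0"
  shows "is_arg_min (objF x src tgt a d e) P z \<longleftrightarrow>
    is_arg_min (\<lambda>z. (Rint x src tgt z + a + e) \<bullet> (Rint x src tgt z + a + e)) P z"
proof -
  have "0 < 1/2 * (1 / d^3)" using assms by simp
  then show ?thesis
    unfolding is_arg_min_def objF_def by (simp only: mult_less_cancel_left_pos)
qed

theorem theorem5p1:
  fixes x :: "'i::finite + 'b::finite \<Rightarrow> real^2"
    and rad :: "'i + 'b \<Rightarrow> real"
    and \<Omega> :: "(real^2) set"
    and \<tau> :: "('i + 'b) set set"
    and src tgt :: "'e::finite \<Rightarrow> 'i + 'b"
    and M :: nat and I :: "nat \<Rightarrow> 'b set"
    and c xstar :: "nat \<Rightarrow> real^2" and \<alpha> :: "nat \<Rightarrow> real"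
    and g :: "real^2^'b"
    and a :: "real^'e"
    and d0 :: real and \<delta>0 :: "'i + 'b \<Rightarrow> 'i + 'b \<Rightarrow> real"
  assumes packing: "disk_packing x rad"
    and edges: "edge_enum x rad src tgt"
    and domain: "polygonal_domain \<Omega>" "triangulates x rad \<Omega> \<tau>" "delaunay_contact_graph x rad"
    and located: "located_wrt x \<Omega>"
    and groups: "boundary_groups x rad M I"
    and bdata: "boundary_data x M I c \<alpha> xstar g"
    and a_def: "a = Rbdry x src tgt g"
    and no_new: "no_new_contacts x rad g"
    and params: "d0 > 0"
      "\<And>i j. contact x rad i j \<Longrightarrow> \<delta>0 i j \<in> {1/2..1} \<and> \<delta>0 i j = \<delta>0 j i"
    and A1: "\<exists>u. is_arg_min (energyQ x rad d0 \<delta>0) (satisfies_bc g) u \<and> \<not> lin_impenetrable x rad u"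
      "\<exists>z. feasible x src tgt a z"
    and A2: "regular_triangulation x rad \<tau>"
    and A3: "\<And>b b'. contact x rad (Inr b) (Inr b') \<Longrightarrow>
       norm ((x (Inr b) + g $ b) - (x (Inr b') + g $ b'))
         \<le> rad (Inr b) + rad (Inr b') + Min (range rad)"
  shows "\<exists>dstar>0. \<exists>\<delta>::real^'e. (\<forall>l. \<delta> $ l \<in> {-1<..<-1/2}) \<and>
     (\<forall>d>dstar.
        (\<exists>!z. is_arg_min (objF x src tgt a d (d *\<^sub>R \<delta>)) (feasible x src tgt a) z) \<and>
        (\<forall>z. is_arg_min (objF x src tgt a d (d *\<^sub>R \<delta>)) (feasible x src tgt a) z \<longrightarrow>
          (\<forall>i. \<exists>l1 l2 j1 j2. l1 \<noteq> l2 \<and>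
             {src l1, tgt l1} = {Inl i, j1} \<and> {src l2, tgt l2} = {Inl i, j2} \<and>
             active x src tgt a z l1 \<and> active x src tgt a z l2 \<and>
             qvec x (Inl i) j1 \<noteq> qvec x (Inl i) j2 \<and>
             independent {qvec x (Inl i) j1, qvec x (Inl i) j2})))"
proof -
  interpret contact_triangulation x \<tau> rad
    by (rule contact_triangulationI[OF packing domain(2)])
  define L where "L = Rint x src tgt"
  have "linear L" unfolding L_def by (rule linear_Rint)
  have "inj L"
    unfolding linear_injective_0[OF \<open>linear L\<close>]
  proof (intro allI impI)
    fix z assume "L z = 0"
    \<comment> \<open>Some boundary vertex exists and touches another of its group: these are the
      two fixed points for \<open>motion_eq_0\<close>.\<close>
    obtain b :: 'b and m where "m \<in> {1..M}" "b \<in> I m"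
      using groups unfolding boundary_groups_def by blast
    then obtain b' where b': "contact x rad (Inr b) (Inr b')"
      using groups unfolding boundary_groups_def by blast
    have "stack z (0 :: real^2^'b) $ v = 0" for v
    proof (rule motion_eq_0[where u = "($) (stack z (0 :: real^2^'b))"])
      show "triangle_built \<tau> UNIV (contact_edges x rad)"
        using A2 by (simp add: regular_triangulation_def)
      show "(stack z (0 :: real^2^'b) $ j - stack z (0 :: real^2^'b) $ i) \<bullet> (x j - x i) = 0" if "contact x rad i j" for i j
        using Rr_eq_0_edge[OF edges _ that] \<open>L z = 0\<close> by (simp add: L_def Rint_def)
      show "stack z (0 :: real^2^'b) $ Inr b = 0" "stack z (0 :: real^2^'b) $ Inr b' = 0" by (simp_all add: stack_def)
      show "Inr b \<noteq> (Inr b' :: 'i + 'b)" using b' by (simp add: contact_def)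
    qed
    from this[of "Inl _"] show "z = 0" by (simp add: stack_def vec_eq_iff)
  qed
  have poly: "polytope {y \<in> range (\<lambda>z. L z + a). 0 \<le> y}"
  proof (rule polytope_of_positive_relation[OF \<open>linear L\<close>])
    let ?\<omega> = "\<chi> l. stress (src l) (tgt l)"
    show "?\<omega> \<bullet> L z = 0" for z
    proof -
      \<comment> \<open>Interior vertices carry no resultant force, boundary vertices no
        displacement.\<close>
      have "stack z (0 :: real^2^'b) $ i \<bullet> (\<Sum>j\<in>nbrs x rad i. stress i j *\<^sub>R qvec x i j) = 0" for i
      proof (cases i)
        case (Inl k)
        then show ?thesis
          using equilibrium[of "Inl k"]
            midpoint_in_interior_triangulation[OF domain(1,2) located, of k] by simp
      qed (simp add: stack_def)
      then show ?thesis
        unfolding L_def Rint_def virtual_work[where \<omega> = stress, OF edges stress_commute] by simp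
    qed
    show "?\<omega> $ l > 0" for l using stress_pos[OF edge_enum_contact[OF edges]] by simp
  qed
  obtain z0 where z0: "0 \<le> L z0 + a" using A1(2) by (auto simp: feasible_def L_def)
  have quarter: "(0::real) < 1/4" by simp
  \<comment> \<open>The centre and half the length of the interval from -1 to -1/2, so that every
    component of \<delta> falls inside it.\<close>
  obtain \<delta> z D where \<delta>: "norm (\<delta> - (\<chi> l. -3/4)) < 1/4" and "D > 0"
    and min: "\<And>d z'. d > D \<Longrightarrow>
        is_arg_min (\<lambda>z. (L z + a + d *\<^sub>R \<delta>) \<bullet> (L z + a + d *\<^sub>R \<delta>)) (\<lambda>z. 0 \<le> L z + a) z' \<longleftrightarrow> z' = z"
    and vertex: "\<forall>h. (\<forall>l. (L z + a) $ l = 0 \<longrightarrow> L h $ l = 0) \<longrightarrow> h = 0"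
    by (rule least_squares_at_vertex[OF \<open>linear L\<close> \<open>inj L\<close> poly z0 quarter]) (rule that)
  have feasible_eq: "feasible x src tgt a = (\<lambda>z. 0 \<le> L z + a)"
    by (simp add: feasible_def L_def fun_eq_iff)
  have argmin: "is_arg_min (objF x src tgt a d (d *\<^sub>R \<delta>)) (feasible x src tgt a) z' \<longleftrightarrow> z' = z"
    if "d > D" for d z'
    using min[OF that] that \<open>D > 0\<close> by (simp add: is_arg_min_objF_iff feasible_eq flip: L_def)
  show ?thesis
  proof (intro exI[of _ D] exI[of _ \<delta>] conjI allI impI \<open>D > 0\<close>)
    show "\<delta> $ l \<in> {-1<..<-1/2}" for l
      using component_le_norm_cart[of "\<delta> - (\<chi> l. -3/4)" l] \<delta> by auto
    fix d assume "d > D"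
    note argmin = argmin[OF this]
    show "\<exists>!z. is_arg_min (objF x src tgt a d (d *\<^sub>R \<delta>)) (feasible x src tgt a) z"
      by (simp add: argmin)
    fix z' i assume "is_arg_min (objF x src tgt a d (d *\<^sub>R \<delta>)) (feasible x src tgt a) z'"
    then have "z' = z" by (simp only: argmin)
    show "\<exists>l1 l2 j1 j2. l1 \<noteq> l2 \<and>
             {src l1, tgt l1} = {Inl i, j1} \<and> {src l2, tgt l2} = {Inl i, j2} \<and>
             active x src tgt a z' l1 \<and> active x src tgt a z' l2 \<and>
             qvec x (Inl i) j1 \<noteq> qvec x (Inl i) j2 \<and>
             independent {qvec x (Inl i) j1, qvec x (Inl i) j2}"
      unfolding \<open>z' = z\<close>
    proof (rule spanning_active_edges[OF edges])
      fix h assume "\<And>l. active x src tgt a z l \<Longrightarrow> Rint x src tgt h $ l = 0"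
      then show "h = 0" using vertex by (simp add: active_def flip: L_def)
    qed
  qed
qed

end
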